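(* Let $\theta=\theta^*:=\dfrac{\sqrt{\alpha_2\lambda_2}}{\sqrt{\alpha_1\lambda_1}+\sqrt{\alpha_2\lambda_2}}$ and suppose $\sqrt{\alpha_1/\lambda_1}\,a>\sqrt{\alpha_2/\lambda_2}\,b$. Then, for $h^0\in L^2(0,T)$ and every $k\ge1$, the error $h^k$ of the continuous Dirichlet--Neumann waveform relaxation (DNWR) iteration satisfies $$\|h^k\|_{L^2(0,T)}\le\left(2\,\frac{1-\sqrt{\frac{\alpha_2\lambda_1}{\alpha_1\lambda_2}}\frac{b}{a}}{1+\sqrt{\frac{\alpha_2\lambda_2}{\alpha_1\lambda_1}}}\right)^k e^{-\frac{\alpha_2k^2b^2}{4\lambda_2T}}\,\|h^0\|_{L^2(0,T)}.$$
   Context: Let $a,b,T>0$ and let $\alpha_j,\lambda_j>0$ ($j=1,2$) be constants (volumetric heat capacities and heat conductivities). Put $Q_1=(-a,0)\times(0,T)$ and $Q_2=(0,b)\times(0,T)$. The DNWR iteration solves two heat equations $\alpha_j\partial_t u_j-\lambda_j\partial_{xx}u_j=f_j$ in $Q_j$ with given initial data, outer Dirichlet data at $x=-a$ and $x=b$, and continuity of temperature and of heat flux at $x=0$. By linearity, its error is described by the same iteration with all sources, initial data and outer boundary data equal to zero: given the initial interface error $h^0$, for $k=0,1,2,\dots$ solve $$\alpha_1\partial_t u_1^{k+1}-\lambda_1\partial_{xx}u_1^{k+1}=0\ \text{in }Q_1,\quad u_1^{k+1}(-a,t)=0,\quad u_1^{k+1}(0,t)=h^k(t),\quad u_1^{k+1}(x,0)=0,$$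 then $$\alpha_2\partial_t u_2^{k+1}-\lambda_2\partial_{xx}u_2^{k+1}=0\ \text{in }Q_2,\quad -\lambda_2\partial_x u_2^{k+1}(0,t)=-\lambda_1\partial_x u_1^{k+1}(0,t),\quad u_2^{k+1}(b,t)=0,\quad u_2^{k+1}(x,0)=0,$$ and update $$h^{k+1}(t)=(1-\theta)h^k(t)+\theta u_2^{k+1}(0,t),$$ where $\theta\in(0,1)$ is the relaxation parameter. The solutions are understood in the generalized sense of Lions--Magenes (Non-Homogeneous Boundary Value Problems and Applications II, Chapter 4), for which $h^k$ is well defined when $h^0\in L^2(0,T)$. *)

theory Defs
  imports "HOL-Analysis.Analysis"
begin

definition L2_on :: "'a::euclidean_space set \<Rightarrow> ('a \<Rightarrow> real) \<Rightarrow> bool" where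
  "L2_on S f \<longleftrightarrow> set_borel_measurable lborel S f \<and> set_integrable lborel S (\<lambda>x. (f x)\<^sup>2)"

definition L2_norm_on :: "'a::euclidean_space set \<Rightarrow> ('a \<Rightarrow> real) \<Rightarrow> real" where
  "L2_norm_on S f = sqrt (LINT x:S|lborel. (f x)\<^sup>2)"

text \<open>\<open>\<phi>\<close> is of class \<open>C\<^sup>2\<close> in \<open>x\<close> and \<open>C\<^sup>1\<close> in \<open>t\<close> up to the boundary of
  \<open>[p,q] \<times> [0,T]\<close>, with derivatives \<open>\<phi>\<^sub>t\<close>, \<open>\<phi>\<^sub>x\<close>, \<open>\<phi>\<^sub>x\<^sub>x\<close> (one-sided on the boundary).\<close>

definition C21_on ::
  "real \<Rightarrow> real \<Rightarrow> real \<Rightarrow> (real \<times> real \<Rightarrow> real) \<Rightarrow> (real \<times> real \<Rightarrow> real) \<Rightarrow>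
   (real \<times> real \<Rightarrow> real) \<Rightarrow> (real \<times> real \<Rightarrow> real) \<Rightarrow> bool" where
  "C21_on p q T \<phi> \<phi>\<^sub>t \<phi>\<^sub>x \<phi>\<^sub>x\<^sub>x \<longleftrightarrow>
     (\<forall>x\<in>{p..q}. \<forall>t\<in>{0..T}.
        ((\<lambda>s. \<phi> (x, s)) has_real_derivative \<phi>\<^sub>t (x, t)) (at t within {0..T}) \<and>
        ((\<lambda>y. \<phi> (y, t)) has_real_derivative \<phi>\<^sub>x (x, t)) (at x within {p..q}) \<and>
        ((\<lambda>y. \<phi>\<^sub>x (y, t)) has_real_derivative \<phi>\<^sub>x\<^sub>x (x, t)) (at x within {p..q})) \<and>
     (\<forall>f\<in>{\<phi>, \<phi>\<^sub>t, \<phi>\<^sub>x, \<phi>\<^sub>x\<^sub>x}. continuous_on ({p..q} \<times> {0..T}) f)"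

text \<open>Generalized solution, by transposition, of \<open>\<alpha> u\<^sub>t - \<kappa> u\<^sub>x\<^sub>x = 0\<close> in \<open>(p,q) \<times> (0,T)\<close> with
  \<open>u(x,0) = 0\<close>, together with its boundary data: temperatures \<open>g\<^sub>p\<close>, \<open>g\<^sub>q\<close> in \<open>L\<^sup>2(0,T)\<close> and
  heat fluxes \<open>F\<^sub>p\<close>, \<open>F\<^sub>q\<close> (that is, \<open>-\<kappa> u\<^sub>x\<close>) at \<open>x = p\<close> and \<open>x = q\<close>.  For boundary temperatures
  that are only square integrable, the fluxes are not functions but functionals
  \<open>\<psi> \<mapsto> \<integral> -\<kappa> u\<^sub>x \<psi> dt\<close> on \<open>C\<^sup>1\<close> functions with \<open>\<psi>(T) = 0\<close>.
  The identity below is Green's formula, obtained by multiplying the equation by \<open>\<phi>\<close> and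
  integrating by parts once in \<open>t\<close> and twice in \<open>x\<close>; the initial condition is contained in it
  because \<open>\<phi>(\<sqdot>,0)\<close> is arbitrary.  It determines the fluxes from \<open>u\<close>, \<open>g\<^sub>p\<close>, \<open>g\<^sub>q\<close> (every such
  \<open>\<psi>\<close> is the boundary value of a test function), hence also makes them linear and continuous
  in \<open>\<psi>\<close>; their values on other functions are irrelevant.\<close>

definition generalized_heat_solution ::
  "real \<Rightarrow> real \<Rightarrow> real \<Rightarrow> real \<Rightarrow> real \<Rightarrow> (real \<times> real \<Rightarrow> real) \<Rightarrow>
   (real \<Rightarrow> real) \<Rightarrow> ((real \<Rightarrow> real) \<Rightarrow> real) \<Rightarrow>
   (real \<Rightarrow> real) \<Rightarrow> ((real \<Rightarrow> real) \<Rightarrow> real) \<Rightarrow> bool" where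
  "generalized_heat_solution \<alpha> \<kappa> T p q u g\<^sub>p F\<^sub>p g\<^sub>q F\<^sub>q \<longleftrightarrow>
     L2_on ({p<..<q} \<times> {0<..<T}) u \<and> L2_on {0<..<T} g\<^sub>p \<and> L2_on {0<..<T} g\<^sub>q \<and>
     (\<forall>\<phi> \<phi>\<^sub>t \<phi>\<^sub>x \<phi>\<^sub>x\<^sub>x. C21_on p q T \<phi> \<phi>\<^sub>t \<phi>\<^sub>x \<phi>\<^sub>x\<^sub>x \<longrightarrow> (\<forall>x\<in>{p..q}. \<phi> (x, T) = 0) \<longrightarrow>
        (LINT z:{p<..<q} \<times> {0<..<T}|lborel. u z * (- \<alpha> * \<phi>\<^sub>t z - \<kappa> * \<phi>\<^sub>x\<^sub>x z)) =
          (F\<^sub>p (\<lambda>t. \<phi> (p, t)) + \<kappa> * (LINT t:{0<..<T}|lborel. g\<^sub>p t * \<phi>\<^sub>x (p, t))) -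
          (F\<^sub>q (\<lambda>t. \<phi> (q, t)) + \<kappa> * (LINT t:{0<..<T}|lborel. g\<^sub>q t * \<phi>\<^sub>x (q, t))))"

text \<open>One step from the interface error \<open>h\<close> to \<open>h'\<close>.  Here \<open>F\<close> is the common flux
  \<open>-\<kappa>\<^sub>2 \<partial>\<^sub>x u\<^sub>2(0,\<sqdot>) = -\<kappa>\<^sub>1 \<partial>\<^sub>x u\<^sub>1(0,\<sqdot>)\<close> at the interface and \<open>g\<close> is the trace \<open>u\<^sub>2(0,\<sqdot>)\<close>; the
  fluxes \<open>F\<^sub>a\<close>, \<open>F\<^sub>b\<close> at the outer boundaries are not prescribed.\<close>

definition dnwr_step ::
  "real \<Rightarrow> real \<Rightarrow> real \<Rightarrow> real \<Rightarrow> real \<Rightarrow> real \<Rightarrow> real \<Rightarrow> real \<Rightarrow>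
   (real \<Rightarrow> real) \<Rightarrow> (real \<Rightarrow> real) \<Rightarrow> bool" where
  "dnwr_step a b T \<alpha>\<^sub>1 \<kappa>\<^sub>1 \<alpha>\<^sub>2 \<kappa>\<^sub>2 \<theta> h h' \<longleftrightarrow>
     (\<exists>u\<^sub>1 u\<^sub>2 F\<^sub>a F F\<^sub>b g.
        generalized_heat_solution \<alpha>\<^sub>1 \<kappa>\<^sub>1 T (- a) 0 u\<^sub>1 (\<lambda>t. 0) F\<^sub>a h F \<and>
        generalized_heat_solution \<alpha>\<^sub>2 \<kappa>\<^sub>2 T 0 b u\<^sub>2 g F (\<lambda>t. 0) F\<^sub>b \<and>
        (AE t in lborel. t \<in> {0<..<T} \<longrightarrow> h' t = (1 - \<theta>) * h t + \<theta> * g t))"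

definition dnwr_errors ::
  "real \<Rightarrow> real \<Rightarrow> real \<Rightarrow> real \<Rightarrow> real \<Rightarrow> real \<Rightarrow> real \<Rightarrow> real \<Rightarrow>
   (nat \<Rightarrow> real \<Rightarrow> real) \<Rightarrow> bool" where
  "dnwr_errors a b T \<alpha>\<^sub>1 \<kappa>\<^sub>1 \<alpha>\<^sub>2 \<kappa>\<^sub>2 \<theta> h \<longleftrightarrow>
     (\<forall>k. dnwr_step a b T \<alpha>\<^sub>1 \<kappa>\<^sub>1 \<alpha>\<^sub>2 \<kappa>\<^sub>2 \<theta> (h k) (h (Suc k)))"

end

theory Submission
  imports Defs "HOL-Real_Asymp.Real_Asymp" "HOL-Computational_Algebra.Polynomial"
begin

text \<open>
  Measure lengths so that both diffusivities are one: the subdomains get the lengths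
  \<open>A = sqrt (\<alpha>\<^sub>1 / \<kappa>\<^sub>1) * a\<close> and \<open>B = sqrt (\<alpha>\<^sub>2 / \<kappa>\<^sub>2) * b\<close>, with \<open>B < A\<close>.  After a Laplace transform in
  time, solving the two boundary value problems shows that for the optimal \<open>\<theta>\<close> one step multiplies
  the error by
  \<open>\<rho> (1 - tanh (B r) / tanh (A r)) = \<rho> sinh ((A - B) r) / (sinh (A r) cosh (B r))\<close>, where
  \<open>r = sqrt s\<close> and \<open>\<rho> = 1 - \<theta>\<close>.  For real \<open>r \<ge> 0\<close> the quotient of hyperbolic sines is at most
  \<open>(A - B) / A\<close>, and \<open>1 / cosh (B r) \<le> 2 exp (- B r)\<close>.  If one step has at most this norm in
  \<open>L\<^sup>2(0,T)\<close> with the weight \<open>exp (- s t)\<close>, then \<open>k\<close> steps give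
  \<open>exp (s T - k B r) * (2 \<rho> (A - B) / A) ^ k\<close> in the unweighted norm, and \<open>r = k B / (2 T)\<close> gives
  the claim.

  The weighted estimate of one step is proved without transforms, on the dual side.  Because the
  solutions are only defined by transposition, the step is known through its action on test functions.
  Take a backward heat solution \<open>P\<close> with \<open>P(\<sqdot>,T) = 0\<close>.  Finitely many translates and reflections of
  \<open>P\<close> give test functions on both subdomains that agree at the interface, and the unknown interface
  flux cancels (\<open>dnwr_step_duality\<close>).  What remains says that testing the new error with a trace \<open>W\<close>
  amounts to testing the old error with \<open>\<rho> V\<close>, where \<open>V\<close> arises from \<open>W\<close> by the operator with the
  symbol above.

  The bound of \<open>V\<close> by \<open>W\<close> is an energy argument (\<open>backward_heat_energy\<close>, \<open>trace_energy\<close>): as a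
  function of \<open>x\<close>, the weighted norm of a heat solution over the time interval grows at least like a
  comparison function, which is \<open>x\<close> for the Dirichlet problem behind the quotient of hyperbolic sines,
  and \<open>cosh (r x)\<close> for the Neumann problem behind \<open>1 / cosh (B r)\<close>.

  Finally, the traces \<open>W\<close> are dense (\<open>gauss_kernel_times_continuous_approximable\<close>): their uniform
  closure contains the kernels \<open>c (T - t) powr (- 3 / 2) * exp (- c\<^sup>2 / (4 (T - t)))\<close>, and these span
  enough by the Stone--Weierstrass theorem in the variable \<open>exp (- 1 / (T - t))\<close>.
\<close>

section \<open>Images of classical solutions\<close>

lemma C21_on_affine:
  assumes f: "C21_on p q T f ft fx fxx" and maps: "\<And>x. x \<in> {p'..q'} \<Longrightarrow> m * x + d \<in> {p..q}"
  shows "C21_on p' q' T (\<lambda>z. f (m * fst z + d, snd z)) (\<lambda>z. ft (m * fst z + d, snd z))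
    (\<lambda>z. m * fx (m * fst z + d, snd z)) (\<lambda>z. m\<^sup>2 * fxx (m * fst z + d, snd z))"
proof -
  have chain: "((\<lambda>y. g (m * y + d, t)) has_real_derivative m * g' (m * x + d, t)) (at x within {p'..q'})"
    if D: "\<And>x t. x \<in> {p..q} \<Longrightarrow> t \<in> {0..T} \<Longrightarrow>
        ((\<lambda>y. g (y, t)) has_real_derivative g' (x, t)) (at x within {p..q})"
      and "x \<in> {p'..q'}" "t \<in> {0..T}" for g g' :: "real \<times> real \<Rightarrow> real" and x t
  proof -
    have "((\<lambda>y. g (y, t)) has_real_derivative g' (m * x + d, t))
        (at (m * x + d) within (\<lambda>y. m * y + d) ` {p'..q'})"
      using D[OF maps] that maps by (blast intro: DERIV_subset)
    moreover have "((\<lambda>y. m * y + d) has_real_derivative m) (at x within {p'..q'})"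
      by (auto intro!: derivative_eq_intros)
    ultimately have "((\<lambda>y. g (y, t)) \<circ> (\<lambda>y. m * y + d) has_real_derivative g' (m * x + d, t) * m)
        (at x within {p'..q'})"
      by (rule DERIV_image_chain)
    then show ?thesis by (simp add: o_def mult.commute)
  qed
  have cont: "continuous_on ({p'..q'} \<times> {0..T}) (\<lambda>z. g (m * fst z + d, snd z))"
    if "continuous_on ({p..q} \<times> {0..T}) g" for g :: "real \<times> real \<Rightarrow> real"
    by (rule continuous_on_compose2[OF that]) (use maps in \<open>auto intro!: continuous_intros\<close>)
  have "((\<lambda>y. m * fx (m * y + d, t)) has_real_derivative m * (m * fxx (m * x + d, t))) (at x within {p'..q'})"
    if "x \<in> {p'..q'}" "t \<in> {0..T}" for x t
    using f that unfolding C21_on_def by (intro DERIV_cmult chain) auto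
  then show ?thesis
    using f maps unfolding C21_on_def
    by (auto simp: power2_eq_square mult.assoc intro!: chain cont continuous_intros)
qed

lemma C21_on_lincomb:
  assumes "C21_on p q T f ft fx fxx" "C21_on p q T g gt gx gxx"
  shows "C21_on p q T (\<lambda>z. c * f z + d * g z) (\<lambda>z. c * ft z + d * gt z)
    (\<lambda>z. c * fx z + d * gx z) (\<lambda>z. c * fxx z + d * gxx z)"
  using assms unfolding C21_on_def
  by (auto intro!: continuous_intros DERIV_add DERIV_cmult)

text \<open>Placing copies of a profile \<open>f\<close> at \<open>x + e\<close>, \<open>x - e\<close>, \<open>e - x\<close> and \<open>- e - x\<close> is the method of
images.  In the Laplace variable a translation by \<open>d\<close> of a profile decaying like
\<open>exp (- x * sqrt s)\<close> is a multiplication by \<open>exp (- d * sqrt s)\<close>, so the sign patterns of the four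
coefficients give exactly the products of a hyperbolic function of \<open>x\<close> with one of \<open>e\<close>: for
instance \<open>(1, -1, -1, 1)\<close> is \<open>sinh * sinh\<close> and \<open>(1, 1, -1, -1)\<close> is \<open>sinh * cosh\<close>, up to a factor.\<close>

definition images ::
  "real \<Rightarrow> real \<Rightarrow> real \<Rightarrow> real \<Rightarrow> real \<Rightarrow> (real \<times> real \<Rightarrow> real) \<Rightarrow> real \<times> real \<Rightarrow> real" where
  "images k\<^sub>1 k\<^sub>2 k\<^sub>3 k\<^sub>4 e f = (\<lambda>(x, t).
     k\<^sub>1 * f (x + e, t) + k\<^sub>2 * f (x - e, t) + k\<^sub>3 * f (e - x, t) + k\<^sub>4 * f (- e - x, t))"

lemma images_minus:
  "images k\<^sub>1 k\<^sub>2 k\<^sub>3 k\<^sub>4 e (\<lambda>z. - f z) z = - images k\<^sub>1 k\<^sub>2 k\<^sub>3 k\<^sub>4 e f z"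
  by (simp add: images_def case_prod_unfold)

lemma images_eq_0:
  assumes "\<And>x. x \<in> {- L..L} \<Longrightarrow> f (x, t) = 0" and "\<bar>x\<bar> + \<bar>e\<bar> \<le> L"
  shows "images k\<^sub>1 k\<^sub>2 k\<^sub>3 k\<^sub>4 e f (x, t) = 0"
proof -
  have "f (x + e, t) = 0" "f (x - e, t) = 0" "f (e - x, t) = 0" "f (- e - x, t) = 0"
    using assms(2) by (intro assms(1); auto)+
  then show ?thesis by (simp add: images_def)
qed

lemma C21_on_images:
  assumes f: "C21_on (- L) L T f ft fx fxx" and dom: "\<And>x. x \<in> {p..q} \<Longrightarrow> \<bar>x\<bar> + \<bar>e\<bar> \<le> L"
  shows "C21_on p q T (images k\<^sub>1 k\<^sub>2 k\<^sub>3 k\<^sub>4 e f) (images k\<^sub>1 k\<^sub>2 k\<^sub>3 k\<^sub>4 e ft)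
    (images k\<^sub>1 k\<^sub>2 (- k\<^sub>3) (- k\<^sub>4) e fx) (images k\<^sub>1 k\<^sub>2 k\<^sub>3 k\<^sub>4 e fxx)"
proof -
  note shift = C21_on_affine[OF f, of p q]
  have 1: "C21_on p q T (\<lambda>z. f (1 * fst z + e, snd z)) (\<lambda>z. ft (1 * fst z + e, snd z))
    (\<lambda>z. 1 * fx (1 * fst z + e, snd z)) (\<lambda>z. 1\<^sup>2 * fxx (1 * fst z + e, snd z))"
    by (rule shift) (use dom in force)
  have 2: "C21_on p q T (\<lambda>z. f (1 * fst z + - e, snd z)) (\<lambda>z. ft (1 * fst z + - e, snd z))
    (\<lambda>z. 1 * fx (1 * fst z + - e, snd z)) (\<lambda>z. 1\<^sup>2 * fxx (1 * fst z + - e, snd z))"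
    by (rule shift) (use dom in force)
  have 3: "C21_on p q T (\<lambda>z. f (- 1 * fst z + e, snd z)) (\<lambda>z. ft (- 1 * fst z + e, snd z))
    (\<lambda>z. - 1 * fx (- 1 * fst z + e, snd z)) (\<lambda>z. (- 1)\<^sup>2 * fxx (- 1 * fst z + e, snd z))"
    by (rule shift) (use dom in force)
  have 4: "C21_on p q T (\<lambda>z. f (- 1 * fst z + - e, snd z)) (\<lambda>z. ft (- 1 * fst z + - e, snd z))
    (\<lambda>z. - 1 * fx (- 1 * fst z + - e, snd z)) (\<lambda>z. (- 1)\<^sup>2 * fxx (- 1 * fst z + - e, snd z))"
    by (rule shift) (use dom in force)
  from C21_on_lincomb[OF C21_on_lincomb[OF 1 2, of k\<^sub>1 k\<^sub>2] C21_on_lincomb[OF 3 4, of k\<^sub>3 k\<^sub>4], of 1 1]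
  show ?thesis by (simp add: images_def case_prod_unfold algebra_simps)
qed

section \<open>Growth of the weighted energy in space\<close>

text \<open>Write \<open>v = S * y\<close>.  Multiplying the equation for \<open>y\<close> by \<open>y\<close> and integrating shows that
\<open>E = \<integral> exp (2 s t) S\<^sup>2 y y\<^sub>x dt\<close> is nondecreasing in \<open>x\<close>: besides a square, its derivative
contains only \<open>(s - S''/S)\<close> times the energy and the initial value \<open>v(x,0)\<^sup>2 / 2\<close>, since \<open>v\<close>
vanishes at the final time; the term with \<open>s\<close> comes from differentiating the weight.  The boundary
condition says \<open>E = 0\<close> at the left end, so \<open>E \<ge> 0\<close>, and \<open>2 E / S\<^sup>2\<close> is the derivative of
the weighted squared norm of \<open>y\<close>.  Thus the norm of a solution grows in \<open>x\<close> at least as fast as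
a positive \<open>S\<close> with \<open>S'' \<le> s S\<close>.\<close>

lemma backward_heat_energy:
  assumes v: "C21_on p q T v vt vx vxx"
    and heat: "\<And>x t. x \<in> {p..q} \<Longrightarrow> t \<in> {0..T} \<Longrightarrow> vt (x, t) = - vxx (x, t)"
    and terminal: "\<And>x. x \<in> {p..q} \<Longrightarrow> v (x, T) = 0" and "T > 0"
    and S: "\<And>x. x \<in> {p..q} \<Longrightarrow> S x > 0"
      "\<And>x. x \<in> {p..q} \<Longrightarrow> (S has_real_derivative S' x) (at x within {p..q})"
      "\<And>x. x \<in> {p..q} \<Longrightarrow> (S' has_real_derivative S'' x) (at x within {p..q})"
      "\<And>x. x \<in> {p..q} \<Longrightarrow> S'' x \<le> s * S x"
    and bdry: "\<And>t. t \<in> {0..T} \<Longrightarrow> v (p, t) = 0 \<or> (vx (p, t) = 0 \<and> S' p = 0)"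
    and xy: "p \<le> x" "x \<le> y" "y \<le> q"
  shows "integral {0..T} (\<lambda>t. exp (2 * s * t) * (v (x, t))\<^sup>2) / (S x)\<^sup>2
    \<le> integral {0..T} (\<lambda>t. exp (2 * s * t) * (v (y, t))\<^sup>2) / (S y)\<^sup>2"
proof -
  define N where "N x = integral {0..T} (\<lambda>t. exp (2 * s * t) * (v (x, t))\<^sup>2)" for x
  define J where "J x = integral {0..T} (\<lambda>t. exp (2 * s * t) * (v (x, t) * vx (x, t)))" for x
  define J' where "J' x = integral {0..T} (\<lambda>t. exp (2 * s * t) * ((vx (x, t))\<^sup>2 + v (x, t) * vxx (x, t)))" for x
  \<comment> \<open>This is \<open>\<integral> exp (2 s t) S\<^sup>2 y y\<^sub>x dt\<close> for \<open>y = v / S\<close>.\<close>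
  define E where "E x = J x - S' x / S x * N x" for x
  have cont2: "continuous_on ({p..q} \<times> {0..T}) v" "continuous_on ({p..q} \<times> {0..T}) vx"
     "continuous_on ({p..q} \<times> {0..T}) vxx"
    using v by (auto simp: C21_on_def)
  have slice: "continuous_on {0..T} (\<lambda>t. f (x, t))"
    if "continuous_on ({p..q} \<times> {0..T}) f" "x \<in> {p..q}" for f :: "real \<times> real \<Rightarrow> real" and x
    by (rule continuous_on_compose2[OF that(1)]) (use that(2) in \<open>auto intro!: continuous_intros\<close>)
  note cont1 = cont2[THEN slice]
  have derivs: "((\<lambda>y. v (y, t)) has_real_derivative vx (x, t)) (at x within {p..q})"
     "((\<lambda>y. vx (y, t)) has_real_derivative vxx (x, t)) (at x within {p..q})"
     "((\<lambda>s. v (x, s)) has_real_derivative vt (x, t)) (at t within {0..T})"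
    if "x \<in> {p..q}" "t \<in> {0..T}" for x t
    using v that by (auto simp: C21_on_def)
  have N: "(N has_real_derivative 2 * J x) (at x within {p..q})" if x: "x \<in> {p..q}" for x
  proof -
    have "((\<lambda>x. integral (cbox 0 T) (\<lambda>t. exp (2 * s * t) * (v (x, t))\<^sup>2)) has_real_derivative
        integral (cbox 0 T) (\<lambda>t. 2 * (exp (2 * s * t) * (v (x, t) * vx (x, t))))) (at x within {p..q})"
      by (rule leibniz_rule_field_derivative)
         (use x in \<open>auto intro!: integrable_continuous_real continuous_intros cont1 cont2
            derivative_eq_intros derivs simp: case_prod_unfold\<close>)
    then show ?thesis by (simp add: N_def[abs_def] J_def)
  qed
  have J: "(J has_real_derivative J' x) (at x within {p..q})" if x: "x \<in> {p..q}" for x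
  proof -
    have "((\<lambda>x. integral (cbox 0 T) (\<lambda>t. exp (2 * s * t) * (v (x, t) * vx (x, t)))) has_real_derivative
        integral (cbox 0 T) (\<lambda>t. exp (2 * s * t) * ((vx (x, t))\<^sup>2 + v (x, t) * vxx (x, t)))) (at x within {p..q})"
      by (rule leibniz_rule_field_derivative)
         (use x in \<open>auto intro!: integrable_continuous_real continuous_intros cont1 cont2
            derivative_eq_intros derivs simp: case_prod_unfold power2_eq_square\<close>)
    then show ?thesis by (simp add: J_def[abs_def] J'_def)
  qed
  \<comment> \<open>The equation replaces \<open>v v\<^sub>x\<^sub>x\<close> by \<open>- v v\<^sub>t\<close>, an exact time derivative up to the weight.\<close>
  have parts: "integral {0..T} (\<lambda>t. exp (2 * s * t) * (v (x, t) * vxx (x, t))) \<ge> s * N x"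
    if x: "x \<in> {p..q}" for x
  proof -
    have "((\<lambda>t. exp (2 * s * t) * (v (x, t))\<^sup>2 * s - exp (2 * s * t) * (v (x, t) * vxx (x, t)))
       has_integral exp (2 * s * T) * (v (x, T))\<^sup>2 / 2 - exp (2 * s * 0) * (v (x, 0))\<^sup>2 / 2) {0..T}"
      using \<open>T > 0\<close> x
      by (intro fundamental_theorem_of_calculus)
         (auto simp flip: has_real_derivative_iff_has_vector_derivative
            intro!: derivative_eq_intros derivs simp: heat field_simps power2_eq_square)
    then have "integral {0..T} (\<lambda>t. exp (2 * s * t) * (v (x, t))\<^sup>2 * s - exp (2 * s * t) * (v (x, t) * vxx (x, t)))
       = - (v (x, 0))\<^sup>2 / 2"
      using terminal[OF x] by (simp add: integral_unique)
    moreover have "integral {0..T} (\<lambda>t. exp (2 * s * t) * (v (x, t))\<^sup>2 * s - exp (2 * s * t) * (v (x, t) * vxx (x, t)))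
       = N x * s - integral {0..T} (\<lambda>t. exp (2 * s * t) * (v (x, t) * vxx (x, t)))"
      using x unfolding N_def
      by (subst integral_diff) (auto intro!: integrable_continuous_real continuous_intros cont1)
    ultimately show ?thesis
      by (simp add: algebra_simps)
  qed
  have E: "\<exists>D. (E has_real_derivative D) (at x within {p..q}) \<and> D \<ge> 0" if x: "x \<in> {p..q}" for x
  proof -
    let ?c = "S' x / S x"
    let ?D = "J' x - ((S'' x * S x - S' x * S' x) / (S x * S x) * N x + 2 * J x * ?c)"
    have "(E has_real_derivative ?D) (at x within {p..q})"
      unfolding E_def[abs_def] using S(1)[OF x]
      by (intro DERIV_diff DERIV_mult DERIV_divide J N S x) auto
    moreover have "?D \<ge> 0"
    proof -
      have int: "(\<lambda>t. exp (2 * s * t) * (v (x, t))\<^sup>2) integrable_on {0..T}"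
         "(\<lambda>t. exp (2 * s * t) * (vx (x, t))\<^sup>2) integrable_on {0..T}"
         "(\<lambda>t. exp (2 * s * t) * (v (x, t) * vx (x, t))) integrable_on {0..T}"
         "(\<lambda>t. exp (2 * s * t) * (v (x, t) * vxx (x, t))) integrable_on {0..T}"
        using x by (auto intro!: integrable_continuous_real continuous_intros cont1)
      have "0 \<le> integral {0..T} (\<lambda>t. exp (2 * s * t) * (vx (x, t) - ?c * v (x, t))\<^sup>2)"
        using x less_imp_neq[OF S(1)[OF x]] by (intro integral_nonneg) (auto intro!: integrable_continuous_real continuous_intros cont1)
      also have "\<dots> = integral {0..T} (\<lambda>t. exp (2 * s * t) * (vx (x, t))\<^sup>2
          - 2 * ?c * (exp (2 * s * t) * (v (x, t) * vx (x, t))) + ?c\<^sup>2 * (exp (2 * s * t) * (v (x, t))\<^sup>2))"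
        by (rule arg_cong[where f = "integral _"]) (auto simp: fun_eq_iff power2_eq_square algebra_simps)
      also have "\<dots> = integral {0..T} (\<lambda>t. exp (2 * s * t) * (vx (x, t))\<^sup>2) - 2 * ?c * J x + ?c\<^sup>2 * N x"
        unfolding J_def N_def
        using has_integral_add[OF has_integral_diff[OF integrable_integral[OF int(2)]
            has_integral_mult_right[OF integrable_integral[OF int(3)], of "2 * ?c"]]
          has_integral_mult_right[OF integrable_integral[OF int(1)], of "?c\<^sup>2"]]
        by (rule integral_unique)
      finally have 1: "0 \<le> integral {0..T} (\<lambda>t. exp (2 * s * t) * (vx (x, t))\<^sup>2) - 2 * ?c * J x + ?c\<^sup>2 * N x" .
      have 2: "J' x = integral {0..T} (\<lambda>t. exp (2 * s * t) * (vx (x, t))\<^sup>2)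
          + integral {0..T} (\<lambda>t. exp (2 * s * t) * (v (x, t) * vxx (x, t)))"
        unfolding J'_def using int by (simp add: distrib_left integral_add)
      have "N x \<ge> 0"
        unfolding N_def by (intro integral_nonneg int) auto
      then have 3: "S'' x / S x * N x \<le> s * N x"
        using S(1,4)[OF x] by (intro mult_right_mono) (auto simp: field_simps)
      have "(S'' x * S x - S' x * S' x) / (S x * S x) = S'' x / S x - ?c\<^sup>2"
        using S(1)[OF x] by (simp add: field_simps power2_eq_square)
      then have "(S'' x * S x - S' x * S' x) / (S x * S x) * N x + 2 * J x * ?c
          = S'' x / S x * N x - ?c\<^sup>2 * N x + 2 * ?c * J x"
        by (simp only: left_diff_distrib) simp
      with 1 2 3 parts[OF x] show ?thesis by linarith
    qed
    ultimately show ?thesis by blast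
  qed
  have mono: "f x \<le> f y"
    if D: "\<And>x. x \<in> {p..q} \<Longrightarrow> \<exists>D. (f has_real_derivative D) (at x within {p..q}) \<and> D \<ge> 0"
      and "p \<le> x" "x \<le> y" "y \<le> q" for f :: "real \<Rightarrow> real" and x y
  proof (rule DERIV_nonneg_imp_increasing_open[OF \<open>x \<le> y\<close>])
    show "\<exists>D. (f has_real_derivative D) (at z) \<and> D \<ge> 0" if "x < z" "z < y" for z
      using D[of z] that \<open>p \<le> x\<close> \<open>y \<le> q\<close> at_within_Icc_at[of p z q] by auto
    have "continuous_on {p..q} f"
      using D by (meson DERIV_continuous continuous_on_eq_continuous_within)
    then show "continuous_on {x..y} f"
      by (rule continuous_on_subset) (use \<open>p \<le> x\<close> \<open>y \<le> q\<close> in auto)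
  qed
  have "E p = 0"
  proof (cases "S' p = 0")
    case True
    have "J p = integral {0..T} (\<lambda>t. 0)"
      unfolding J_def using bdry by (intro integral_cong) fastforce
    with True show ?thesis by (simp add: E_def)
  next
    case False
    then have "v (p, t) = 0" if "t \<in> {0..T}" for t
      using bdry that by blast
    then have "J p = 0" "N p = 0"
      unfolding J_def N_def by (subst integral_cong[where g = "\<lambda>_. 0"]; simp)+
    then show ?thesis by (simp add: E_def)
  qed
  then have E_nonneg: "E z \<ge> 0" if "z \<in> {p..q}" for z
    using mono[OF E, of p z] that by auto
  show ?thesis
    unfolding N_def[symmetric]
  proof (rule mono[OF _ xy])
    fix z assume z: "z \<in> {p..q}"
    let ?D = "(2 * J z * (S z)\<^sup>2 - N z * (2 * (S' z * S z))) / ((S z)\<^sup>2 * (S z)\<^sup>2)"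
    have "((\<lambda>x. N x / (S x)\<^sup>2) has_real_derivative ?D) (at z within {p..q})"
      using S(1)[OF z] DERIV_power[OF S(2)[OF z], of 2] N[OF z]
      by (intro DERIV_divide) auto
    moreover have "?D = 2 * E z / (S z)\<^sup>2"
      using S(1)[OF z] by (simp add: E_def field_simps power2_eq_square)
    ultimately show "\<exists>D. ((\<lambda>x. N x / (S x)\<^sup>2) has_real_derivative D) (at z within {p..q}) \<and> D \<ge> 0"
      using E_nonneg[OF z] by auto
  qed
qed

section \<open>Explicit backward heat solutions\<close>

text \<open>Up to coefficients that are polynomials in \<open>c\<close>, the family is closed under differentiation in
\<open>c\<close> and in \<open>t\<close>; \<open>gauss_kernel 0\<close> is a multiple of
the heat kernel with space variable \<open>c\<close>.  Extended by zero to \<open>t \<le> 0\<close> it is smooth as long as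
\<open>c > 0\<close>, which is what makes it a source of test functions that vanish at one end of the time
interval.\<close>

definition gauss_kernel :: "nat \<Rightarrow> real \<Rightarrow> real \<Rightarrow> real" where
  "gauss_kernel j c t = (if t \<le> 0 then 0 else t powr (- (real j + 1 / 2)) * exp (- (c\<^sup>2 / (4 * t))))"

lemma powr_Suc_half:
  "t > 0 \<Longrightarrow> t powr (- (real (Suc j) + 1 / 2)) = t powr (- (real j + 1 / 2)) / t"
  using powr_diff[of t "- (real j + 1 / 2)" 1] by (simp add: algebra_simps)

lemma gauss_kernel_deriv_space:
  "((\<lambda>c. gauss_kernel j c t) has_real_derivative - (c / 2) * gauss_kernel (Suc j) c t) (at c within S)"
proof (cases "t \<le> 0")
  case False
  then have D: "((\<lambda>c. K * exp (- (c\<^sup>2 / (4 * t)))) has_real_derivative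
      - (c / 2) * (K / t * exp (- (c\<^sup>2 / (4 * t))))) (at c within S)" for K
    by (auto intro!: derivative_eq_intros simp: field_simps)
  have "gauss_kernel (Suc j) c t = t powr (- (real j + 1 / 2)) / t * exp (- (c\<^sup>2 / (4 * t)))"
    using False unfolding gauss_kernel_def by (subst powr_Suc_half) auto
  moreover have "(\<lambda>c. gauss_kernel j c t) = (\<lambda>c. t powr (- (real j + 1 / 2)) * exp (- (c\<^sup>2 / (4 * t))))"
    using False by (auto simp: gauss_kernel_def fun_eq_iff)
  ultimately show ?thesis
    using D by (simp only:)
qed (simp add: gauss_kernel_def)

lemma powr_exp_inverse_tendsto_0:
  fixes k m :: real
  assumes "k > 0" "m > 0"
  shows "((\<lambda>u. u powr (- m) * exp (- (k / u)) / u) \<longlongrightarrow> 0) (at_right 0)"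
  using assms by real_asymp

lemma gauss_kernel_deriv_time:
  assumes "c > 0"
  shows "((\<lambda>t. gauss_kernel j c t) has_real_derivative
    - (real j + 1 / 2) * gauss_kernel (Suc j) c t + c\<^sup>2 / 4 * gauss_kernel (Suc (Suc j)) c t) (at t within S)"
proof -
  consider "t < 0" | "t = 0" | "t > 0" by linarith
  then have "((\<lambda>t. gauss_kernel j c t) has_real_derivative
    - (real j + 1 / 2) * gauss_kernel (Suc j) c t + c\<^sup>2 / 4 * gauss_kernel (Suc (Suc j)) c t) (at t)"
  proof cases
    case 1
    then have "\<forall>\<^sub>F u in nhds t. gauss_kernel j c u = 0"
      by (intro eventually_mono[OF eventually_nhds_in_open[of "{..<0}"]]) (auto simp: gauss_kernel_def)
    then have "(gauss_kernel j c has_real_derivative 0) (at t)"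
      by (subst DERIV_cong_ev[OF refl _ refl]) auto
    moreover have "gauss_kernel i c t = 0" for i
      using 1 by (simp add: gauss_kernel_def)
    ultimately show ?thesis by simp
  next
    case 2
    define m where "m = real j + 1 / 2"
    have "((\<lambda>u. u powr (- m) * exp (- (c\<^sup>2 / 4 / u)) / u) \<longlongrightarrow> 0) (at_right 0)"
      using \<open>c > 0\<close> by (intro powr_exp_inverse_tendsto_0) (auto simp: m_def)
    moreover have "\<forall>\<^sub>F u in at_right 0. u powr (- m) * exp (- (c\<^sup>2 / 4 / u)) / u = gauss_kernel j c u / u"
      by (auto simp: gauss_kernel_def m_def eventually_at_filter)
    ultimately have "((\<lambda>u. gauss_kernel j c u / u) \<longlongrightarrow> 0) (at_right 0)"
      by (rule Lim_transform_eventually)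
    moreover have "((\<lambda>u. gauss_kernel j c u / u) \<longlongrightarrow> 0) (at_left 0)"
      by (rule Lim_transform_eventually[OF tendsto_const])
        (auto simp: gauss_kernel_def eventually_at_filter)
    ultimately have "((\<lambda>u. gauss_kernel j c u / u) \<longlongrightarrow> 0) (at 0)"
      by (rule filterlim_split_at_real[rotated])
    with 2 show ?thesis
      by (simp add: has_field_derivative_iff gauss_kernel_def)
  next
    case 3
    define m where "m = - (real j + 1 / 2)"
    have pw: "t powr (- (real (Suc j) + 1 / 2)) = t powr m / t"
       "t powr (- (real (Suc (Suc j)) + 1 / 2)) = t powr m / t / t"
      unfolding m_def using powr_Suc_half[OF 3, of j] powr_Suc_half[OF 3, of "Suc j"] by (simp_all only:)
    have "((\<lambda>u. u powr m) has_real_derivative m * (t powr m / t)) (at t)"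
      using has_real_derivative_powr[OF 3, of m] powr_diff[of t m 1] 3 by simp
    moreover have "((\<lambda>u. exp (- (c\<^sup>2 / (4 * u)))) has_real_derivative
        c\<^sup>2 / 4 * (exp (- (c\<^sup>2 / (4 * t))) / t / t)) (at t)"
      using 3 by (auto intro!: derivative_eq_intros simp: field_simps power2_eq_square)
    ultimately have "((\<lambda>u. u powr m * exp (- (c\<^sup>2 / (4 * u)))) has_real_derivative
      m * (t powr m / t) * exp (- (c\<^sup>2 / (4 * t)))
        + c\<^sup>2 / 4 * (exp (- (c\<^sup>2 / (4 * t))) / t / t) * t powr m) (at t)"
      by (rule DERIV_mult)
    then have "((\<lambda>u. u powr m * exp (- (c\<^sup>2 / (4 * u)))) has_real_derivative
      m * (t powr m / t * exp (- (c\<^sup>2 / (4 * t)))) + c\<^sup>2 / 4 * (t powr m / t / t * exp (- (c\<^sup>2 / (4 * t))))) (at t)"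
      by (simp add: ac_simps)
    with 3 have "((\<lambda>u. u powr m * exp (- (c\<^sup>2 / (4 * u)))) has_real_derivative
      m * gauss_kernel (Suc j) c t + c\<^sup>2 / 4 * gauss_kernel (Suc (Suc j)) c t) (at t)"
      unfolding gauss_kernel_def pw by simp
    moreover have "\<forall>\<^sub>F u in nhds t. gauss_kernel j c u = u powr m * exp (- (c\<^sup>2 / (4 * u)))"
      using 3 by (intro eventually_mono[OF eventually_nhds_in_open[of "{0<..}"]]) (auto simp: gauss_kernel_def m_def)
    ultimately show ?thesis
      unfolding m_def by (subst DERIV_cong_ev[OF refl _ refl]) auto
  qed
  then show ?thesis by (rule has_field_derivative_at_within)
qed

text \<open>Parabolic scaling reduces the joint continuity at \<open>t = 0\<close> to the continuity of a function of one
variable, and it also gives the decay as \<open>c\<close> tends to infinity.\<close>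

lemma gauss_kernel_scaling:
  assumes "c > 0"
  shows "gauss_kernel j c t = gauss_kernel j 1 (t / c\<^sup>2) / c ^ (2 * j + 1)"
proof (cases "t \<le> 0")
  case False
  then have "t > 0" by simp
  obtain m where m: "m = real j + 1 / 2" by blast
  have "(c\<^sup>2) powr m = c powr (2 * m)"
    using assms powr_powr[of c 2 m] by (simp flip: powr_numeral)
  also have "2 * m = real (2 * j + 1)"
    unfolding m by simp
  also have "c powr real (2 * j + 1) = c ^ (2 * j + 1)"
    using assms by (rule powr_realpow)
  finally have c: "(c\<^sup>2) powr m = c ^ (2 * j + 1)" .
  have "(t / c\<^sup>2) powr (- m) = t powr (- m) / (c\<^sup>2) powr (- m)"
    by (rule powr_divide)
  also have "\<dots> = t powr (- m) * c ^ (2 * j + 1)"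
    by (simp only: powr_minus[of "c\<^sup>2"] c divide_inverse inverse_inverse_eq)
  finally have "(t / c\<^sup>2) powr (- m) = t powr (- m) * c ^ (2 * j + 1)" .
  moreover have "1\<^sup>2 / (4 * (t / c\<^sup>2)) = c\<^sup>2 / (4 * t)" "\<not> t / c\<^sup>2 \<le> 0" "c ^ (2 * j + 1) \<noteq> 0"
    using \<open>t > 0\<close> assms by (auto simp: not_le)
  ultimately show ?thesis
    using False unfolding gauss_kernel_def m[symmetric]
    by (simp only: if_False) simp
qed (use assms in \<open>auto simp: gauss_kernel_def divide_le_0_iff\<close>)

lemma continuous_on_gauss_kernel [continuous_intros]:
  assumes "continuous_on D c" "continuous_on D t" "\<And>z. z \<in> D \<Longrightarrow> c z > 0"
  shows "continuous_on D (\<lambda>z. gauss_kernel j (c z) (t z))"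
proof -
  have "continuous_on UNIV (gauss_kernel j 1)"
    by (rule DERIV_continuous_on) (rule gauss_kernel_deriv_time, simp)
  moreover have "continuous_on D (\<lambda>z. t z / (c z)\<^sup>2)"
    using assms by (intro continuous_on_divide continuous_on_power) force+
  ultimately have "continuous_on D (\<lambda>z. gauss_kernel j 1 (t z / (c z)\<^sup>2))"
    by (rule continuous_on_compose2) simp
  moreover have "continuous_on D (\<lambda>z. c z ^ (2 * j + 1))"
    using assms(1) by (rule continuous_on_power)
  ultimately have "continuous_on D (\<lambda>z. gauss_kernel j 1 (t z / (c z)\<^sup>2) / c z ^ (2 * j + 1))"
    by (rule continuous_on_divide) (use assms(3) in force)
  moreover have "gauss_kernel j (c z) (t z) = gauss_kernel j 1 (t z / (c z)\<^sup>2) / c z ^ (2 * j + 1)" if "z \<in> D" for z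
    using assms(3)[OF that] by (rule gauss_kernel_scaling)
  ultimately show ?thesis
    using continuous_on_eq by (metis (no_types, lifting))
qed

text \<open>The space derivatives \<open>p = P\<^sub>x\<close> of solutions \<open>P\<close> of the backward heat equation \<open>P\<^sub>t = - P\<^sub>x\<^sub>x\<close> that
vanish at the final time.  The test functions are built from \<open>P\<close>, and only \<open>p\<close> enters the
boundary integrals; the energy inequality is applied to \<open>p\<close>, which therefore has to be a classical
solution as well.\<close>

definition heat_profile :: "real \<Rightarrow> real \<Rightarrow> (real \<times> real \<Rightarrow> real) \<Rightarrow> bool" where
  "heat_profile L T p \<longleftrightarrow> (\<exists>P p' p''.
     C21_on (- L) L T P (\<lambda>z. - p' z) p p' \<and> C21_on (- L) L T p (\<lambda>z. - p'' z) p' p'' \<and>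
     (\<forall>x\<in>{- L..L}. P (x, T) = 0 \<and> p (x, T) = 0))"

lemma heat_profile_lincomb:
  assumes "heat_profile L T p" "heat_profile L T q"
  shows "heat_profile L T (\<lambda>z. c * p z + d * q z)"
proof -
  obtain P p' p'' Q q' q'' where
    "C21_on (- L) L T P (\<lambda>z. - p' z) p p'" "C21_on (- L) L T p (\<lambda>z. - p'' z) p' p''"
    "C21_on (- L) L T Q (\<lambda>z. - q' z) q q'" "C21_on (- L) L T q (\<lambda>z. - q'' z) q' q''"
    "\<forall>x\<in>{- L..L}. P (x, T) = 0 \<and> p (x, T) = 0" "\<forall>x\<in>{- L..L}. Q (x, T) = 0 \<and> q (x, T) = 0"
    using assms unfolding heat_profile_def by blast
  then show ?thesis
    unfolding heat_profile_def
    using C21_on_lincomb[of "- L" L T P "\<lambda>z. - p' z" p p' Q "\<lambda>z. - q' z" q q' c d]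
      C21_on_lincomb[of "- L" L T p "\<lambda>z. - p'' z" p' p'' q "\<lambda>z. - q'' z" q' q'' c d]
    by (intro exI[of _ "\<lambda>z. c * P z + d * Q z"] exI[of _ "\<lambda>z. c * p' z + d * q' z"]
        exI[of _ "\<lambda>z. c * p'' z + d * q'' z"]) (simp add: algebra_simps)
qed

text \<open>Minus twice the derivative of \<open>gauss_kernel 0\<close> in \<open>c\<close>; its Laplace transform in \<open>t\<close> is a multiple
of \<open>exp (- c * sqrt s)\<close>.\<close>

definition source_kernel :: "real \<Rightarrow> real \<Rightarrow> real" where
  "source_kernel c t = c * gauss_kernel 1 c t"

lemma heat_profile_source_kernel:
  assumes "z > L"
  shows "heat_profile L T (\<lambda>(x, t). source_kernel (z + x) (T - t))"
proof -
  define P where "P = (\<lambda>(x, t). - 2 * gauss_kernel 0 (z + x) (T - t))"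
  define p where "p = (\<lambda>(x, t). (z + x) * gauss_kernel 1 (z + x) (T - t))"
  define p' where "p' = (\<lambda>(x, t). gauss_kernel 1 (z + x) (T - t) - (z + x)\<^sup>2 / 2 * gauss_kernel 2 (z + x) (T - t))"
  define p'' where "p'' = (\<lambda>(x, t). (z + x) ^ 3 / 4 * gauss_kernel 3 (z + x) (T - t)
    - 3 / 2 * (z + x) * gauss_kernel 2 (z + x) (T - t))"
  have space: "((\<lambda>y. gauss_kernel j (z + y) t) has_real_derivative
      - ((z + x) / 2) * gauss_kernel (Suc j) (z + x) t) (at x within S)" for j x t S
  proof -
    have "((\<lambda>y. z + y) has_real_derivative 1) (at x within S)"
      by (auto intro!: derivative_eq_intros)
    from DERIV_chain2[OF gauss_kernel_deriv_space this] show ?thesis by simp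
  qed
  have time: "((\<lambda>s. gauss_kernel j c (T - s)) has_real_derivative
      (real j + 1 / 2) * gauss_kernel (Suc j) c (T - t) - c\<^sup>2 / 4 * gauss_kernel (Suc (Suc j)) c (T - t))
      (at t within S)" if "c > 0" for j c t S
  proof -
    have "((\<lambda>s. T - s) has_real_derivative -1) (at t within S)"
      by (auto intro!: derivative_eq_intros)
    from DERIV_chain2[OF gauss_kernel_deriv_time[OF that] this] show ?thesis
      by (simp add: algebra_simps)
  qed
  have lin: "((\<lambda>y. z + y) has_real_derivative 1) (at x within S)" for x S
    by (auto intro!: derivative_eq_intros)
  have pos: "z + x > 0" if "x \<in> {- L..L}" for x
    using assms that by auto
  have deriv_space: "((\<lambda>y. P (y, t)) has_real_derivative p (x, t)) (at x within S)"
    "((\<lambda>y. p (y, t)) has_real_derivative p' (x, t)) (at x within S)"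
    "((\<lambda>y. p' (y, t)) has_real_derivative p'' (x, t)) (at x within S)" for x t S
    unfolding P_def p_def p'_def p''_def prod.case
    subgoal by (rule DERIV_cong[OF DERIV_cmult[OF space]]) simp
    subgoal by (rule DERIV_cong[OF DERIV_mult[OF lin space]])
        (simp add: numeral_2_eq_2 power2_eq_square)
    subgoal by (rule DERIV_cong[OF DERIV_diff[OF space
          DERIV_mult[OF DERIV_cdivide[OF DERIV_power[OF lin]] space]]])
        (simp add: numeral_2_eq_2 numeral_3_eq_3 field_simps)
    done
  have deriv_time: "((\<lambda>s. P (x, s)) has_real_derivative - p' (x, t)) (at t within S)"
    "((\<lambda>s. p (x, s)) has_real_derivative - p'' (x, t)) (at t within S)" if "x \<in> {- L..L}" for x t S
    unfolding P_def p_def p'_def p''_def prod.case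
    subgoal by (rule DERIV_cong[OF DERIV_cmult[OF time[OF pos[OF that]]]])
        (simp add: numeral_2_eq_2)
    subgoal by (rule DERIV_cong[OF DERIV_cmult[OF time[OF pos[OF that]]]])
        (simp add: numeral_2_eq_2 numeral_3_eq_3 field_simps)
    done
  have cont: "continuous_on ({- L..L} \<times> {0..T}) P" "continuous_on ({- L..L} \<times> {0..T}) p"
    "continuous_on ({- L..L} \<times> {0..T}) p'" "continuous_on ({- L..L} \<times> {0..T}) p''"
    unfolding P_def p_def p'_def p''_def case_prod_unfold
    by (intro continuous_intros; use pos in force)+
  have zero: "P (x, T) = 0" "p (x, T) = 0" for x
    by (simp_all add: P_def p_def gauss_kernel_def)
  have "heat_profile L T p"
    unfolding heat_profile_def C21_on_def
    using deriv_space deriv_time cont zero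
    by (intro exI[of _ P] exI[of _ p'] exI[of _ p'']) (auto intro!: continuous_on_minus)
  then show ?thesis
    by (simp add: p_def source_kernel_def[abs_def])
qed

section \<open>Norm bounds by duality\<close>

text \<open>The condition \<open>\<integral> 2 f w - w\<^sup>2 \<le> X\<close> is the form in which a bound for the functional
\<open>w \<mapsto> \<integral> f w\<close> is used here: it is stable under dominated convergence, and for \<open>w = f\<close> it says
\<open>\<integral> f\<^sup>2 \<le> X\<close>.\<close>

lemma integral_quadratic_limit:
  fixes f w :: "'a \<Rightarrow> real"
  assumes [measurable]: "f \<in> borel_measurable M" "w \<in> borel_measurable M"
      "\<And>n. w\<^sub>n n \<in> borel_measurable M"
    and f: "integrable M (\<lambda>x. (f x)\<^sup>2)" and g: "integrable M (\<lambda>x. (g x)\<^sup>2)"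
    and lim: "AE x in M. (\<lambda>n. w\<^sub>n n x) \<longlonglongrightarrow> w x"
    and bound: "\<And>n x. x \<in> space M \<Longrightarrow> \<bar>w\<^sub>n n x\<bar> \<le> g x"
    and le: "\<And>n. (\<integral>x. 2 * f x * w\<^sub>n n x - (w\<^sub>n n x)\<^sup>2 \<partial>M) \<le> X"
  shows "(\<integral>x. 2 * f x * w x - (w x)\<^sup>2 \<partial>M) \<le> X"
proof (rule LIMSEQ_le_const2)
  show "(\<lambda>n. \<integral>x. 2 * f x * w\<^sub>n n x - (w\<^sub>n n x)\<^sup>2 \<partial>M) \<longlonglongrightarrow> (\<integral>x. 2 * f x * w x - (w x)\<^sup>2 \<partial>M)"
  proof (rule integral_dominated_convergence)
    show "integrable M (\<lambda>x. (f x)\<^sup>2 + 2 * (g x)\<^sup>2)"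
      using f g by auto
    show "AE x in M. norm (2 * f x * w\<^sub>n n x - (w\<^sub>n n x)\<^sup>2) \<le> (f x)\<^sup>2 + 2 * (g x)\<^sup>2" for n
    proof (rule AE_I2)
      fix x assume "x \<in> space M"
      then have "\<bar>w\<^sub>n n x\<bar> \<le> \<bar>g x\<bar>"
        using bound[of x n] by linarith
      then have "(w\<^sub>n n x)\<^sup>2 \<le> (g x)\<^sup>2"
        by (simp only: abs_le_square_iff)
      moreover have "2 * f x * w\<^sub>n n x \<le> (f x)\<^sup>2 + (w\<^sub>n n x)\<^sup>2"
        by (rule sum_squares_bound)
      moreover have "- (2 * f x * w\<^sub>n n x) \<le> (f x)\<^sup>2 + (w\<^sub>n n x)\<^sup>2"
        using sum_squares_bound[of "f x" "- w\<^sub>n n x"] by simp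
      moreover have "0 \<le> (w\<^sub>n n x)\<^sup>2" by simp
      ultimately show "norm (2 * f x * w\<^sub>n n x - (w\<^sub>n n x)\<^sup>2) \<le> (f x)\<^sup>2 + 2 * (g x)\<^sup>2"
        unfolding real_norm_def by linarith
    qed
    show "AE x in M. (\<lambda>n. 2 * f x * w\<^sub>n n x - (w\<^sub>n n x)\<^sup>2) \<longlonglongrightarrow> 2 * f x * w x - (w x)\<^sup>2"
      using lim by eventually_elim (auto intro!: tendsto_intros)
  qed measurable
qed (use le in auto)

lemma clamp_tendsto:
  fixes x :: real
  shows "(\<lambda>n. max (- real n) (min (real n) x)) \<longlonglongrightarrow> x"
proof (rule tendsto_eventually)
  obtain m :: nat where "\<bar>x\<bar> \<le> m" using real_arch_simple by blast
  then have "max (- real n) (min (real n) x) = x" if "n \<ge> m" for n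
  proof -
    have "real m \<le> real n" using that by simp
    with \<open>\<bar>x\<bar> \<le> m\<close> show ?thesis by linarith
  qed
  then show "\<forall>\<^sub>F n in sequentially. max (- real n) (min (real n) x) = x"
    by (auto simp: eventually_sequentially)
qed

text \<open>Continuous multiples of a fixed positive weight are enough to test with: they converge almost
everywhere to bounded measurable multiples, and truncations of \<open>f / \<omega>\<close> lead from there to \<open>f\<close>
itself.  The truncation keeps \<open>\<bar>w\<bar> \<le> \<bar>f\<bar>\<close>, so that \<open>f\<close> dominates even where \<open>\<omega>\<close> degenerates.\<close>

lemma integral_square_le_by_duality:
  fixes f \<omega> :: "real \<Rightarrow> real" and S :: "real set"
  defines "M \<equiv> restrict_space lborel S"
  assumes S [measurable]: "S \<in> sets borel"
    and [measurable]: "f \<in> borel_measurable M" and f: "integrable M (\<lambda>x. (f x)\<^sup>2)"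
    and \<omega>_meas [measurable]: "\<omega> \<in> borel_measurable M" and \<omega>: "integrable M (\<lambda>x. (\<omega> x)\<^sup>2)"
    and pos: "\<And>x. x \<in> S \<Longrightarrow> \<omega> x > 0"
    and le: "\<And>k. continuous_on UNIV k \<Longrightarrow> (\<integral>x. 2 * f x * (\<omega> x * k x) - (\<omega> x * k x)\<^sup>2 \<partial>M) \<le> X"
  shows "(\<integral>x. (f x)\<^sup>2 \<partial>M) \<le> X"
proof -
  have space: "space M = S" by (simp add: M_def space_restrict_space)
  have M_borel: "h \<in> borel_measurable M" if "h \<in> borel_measurable borel" for h :: "real \<Rightarrow> real"
    using that unfolding M_def by (intro measurable_restrict_space1) simp
  have bounded: "(\<integral>x. 2 * f x * (\<omega> x * k x) - (\<omega> x * k x)\<^sup>2 \<partial>M) \<le> X"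
    if [measurable]: "k \<in> borel_measurable borel" and B: "\<And>x. \<bar>k x\<bar> \<le> B" for k :: "real \<Rightarrow> real" and B
  proof -
    have "k \<in> borel_measurable lebesgue"
      by (rule measurable_completion) simp
    then have "k \<in> borel_measurable (lebesgue_on UNIV)"
      by (rule measurable_restrict_space1)
    then have "k measurable_on UNIV"
      by (simp add: measurable_on_iff_borel_measurable)
    then obtain N g where N: "negligible N" and g: "\<And>n::nat. continuous_on UNIV (g n)"
      and lim: "\<And>x. x \<notin> N \<Longrightarrow> (\<lambda>n. g n x) \<longlonglongrightarrow> k x"
      by (auto simp: measurable_on_def)
    define k\<^sub>n where "k\<^sub>n n x = max (- B) (min B (g n x))" for n x
    have cont: "continuous_on UNIV (k\<^sub>n n)" for n
      unfolding k\<^sub>n_def[abs_def] by (intro continuous_intros g)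
    have [measurable]: "k\<^sub>n n \<in> borel_measurable borel" for n
      using cont by (rule borel_measurable_continuous_onI)
    have [measurable]: "k \<in> borel_measurable M" "k\<^sub>n n \<in> borel_measurable M" for n
      by (auto intro!: M_borel)
    have bnd: "\<bar>k\<^sub>n n x\<bar> \<le> B" for n x
      using B[of x] by (auto simp: k\<^sub>n_def max_def min_def)
    have lim_clamp: "(\<lambda>n. k\<^sub>n n x) \<longlonglongrightarrow> k x" if "x \<notin> N" for x
    proof -
      have "(\<lambda>n. k\<^sub>n n x) \<longlonglongrightarrow> max (- B) (min B (k x))"
        unfolding k\<^sub>n_def by (intro tendsto_intros lim that)
      also have "max (- B) (min B (k x)) = k x"
        using B[of x] by auto
      finally show ?thesis .
    qed
    have "AE x in lebesgue. x \<notin> N"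
      using N by (intro AE_not_in) (simp add: negligible_iff_null_sets)
    then have "AE x in lborel. x \<notin> N"
      by (simp add: AE_completion_iff)
    then have "AE x in lborel. (\<lambda>n. k\<^sub>n n x) \<longlonglongrightarrow> k x"
      by eventually_elim (rule lim_clamp)
    then have "AE x in M. (\<lambda>n. k\<^sub>n n x) \<longlonglongrightarrow> k x"
      unfolding M_def by (subst AE_restrict_space_iff) auto
    then have lim_w: "AE x in M. (\<lambda>n. \<omega> x * k\<^sub>n n x) \<longlonglongrightarrow> \<omega> x * k x"
      by eventually_elim (auto intro!: tendsto_intros)
    show ?thesis
    proof (rule integral_quadratic_limit[OF _ _ _ f _ lim_w, where g = "\<lambda>x. \<omega> x * B"])
      show "integrable M (\<lambda>x. (\<omega> x * B)\<^sup>2)"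
        using \<omega> by (auto simp: power_mult_distrib)
      show "\<bar>\<omega> x * k\<^sub>n n x\<bar> \<le> \<omega> x * B" if "x \<in> space M" for n x
        using bnd[of n x] less_imp_le[OF pos[of x]] that by (simp add: space abs_mult mult_left_mono)
    qed (use le cont in auto)
  qed
  define F where "F x = (if x \<in> S then f x / \<omega> x else 0)" for x
  have F [measurable]: "F \<in> borel_measurable borel"
  proof -
    have "(\<lambda>x. f x / \<omega> x) \<in> borel_measurable M" by measurable
    then have "(\<lambda>x. indicator S x *\<^sub>R (f x / \<omega> x)) \<in> borel_measurable lborel"
      unfolding M_def by (subst (asm) borel_measurable_restrict_space_iff) auto
    also have "(\<lambda>x. indicator S x *\<^sub>R (f x / \<omega> x)) = F"
      by (auto simp: F_def fun_eq_iff indicator_def)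
    finally show ?thesis by simp
  qed
  define k where "k n x = max (- real n) (min (real n) (F x))" for n x
  have k_meas: "k n \<in> borel_measurable borel" for n
    unfolding k_def[abs_def] by measurable
  then have [measurable]: "k n \<in> borel_measurable M" for n
    by (rule M_borel)
  have "(\<integral>x. 2 * f x * f x - (f x)\<^sup>2 \<partial>M) \<le> X"
  proof (rule integral_quadratic_limit[where w\<^sub>n = "\<lambda>n x. \<omega> x * k n x" and g = "\<lambda>x. \<bar>f x\<bar>"])
    have f_eq: "\<omega> x * F x = f x" if "x \<in> S" for x
      using pos[OF that] that by (simp add: F_def)
    show "AE x in M. (\<lambda>n. \<omega> x * k n x) \<longlonglongrightarrow> f x"
    proof (rule AE_I2)
      fix x assume "x \<in> space M"
      then have "x \<in> S" by (simp add: space)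
      have "(\<lambda>n. \<omega> x * k n x) \<longlonglongrightarrow> \<omega> x * F x"
        unfolding k_def by (intro tendsto_intros clamp_tendsto)
      with f_eq[OF \<open>x \<in> S\<close>] show "(\<lambda>n. \<omega> x * k n x) \<longlonglongrightarrow> f x" by simp
    qed
    show "\<bar>\<omega> x * k n x\<bar> \<le> \<bar>f x\<bar>" if "x \<in> space M" for n x
    proof -
      have "\<bar>k n x\<bar> \<le> \<bar>F x\<bar>" by (auto simp: k_def max_def min_def)
      then have "\<bar>\<omega> x\<bar> * \<bar>k n x\<bar> \<le> \<bar>\<omega> x\<bar> * \<bar>F x\<bar>" by (rule mult_left_mono) simp
      with f_eq[of x] that show ?thesis by (simp add: space flip: abs_mult)
    qed
    show "(\<integral>x. 2 * f x * (\<omega> x * k n x) - (\<omega> x * k n x)\<^sup>2 \<partial>M) \<le> X" for n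
      by (rule bounded[of "k n" "real n", OF k_meas]) (auto simp: k_def)
  qed (use f in auto)
  then show ?thesis by (simp add: power2_eq_square)
qed

section \<open>Density of the Neumann traces\<close>

definition uniformly_approximable :: "real \<Rightarrow> (real \<Rightarrow> real) set \<Rightarrow> (real \<Rightarrow> real) \<Rightarrow> bool" where
  "uniformly_approximable T S w \<longleftrightarrow> (\<forall>\<epsilon>>0. \<exists>v\<in>S. \<forall>t\<in>{0..T}. \<bar>w t - v t\<bar> \<le> \<epsilon>)"

locale function_subspace =
  fixes T :: real and S :: "(real \<Rightarrow> real) set"
  assumes lincomb: "v \<in> S \<Longrightarrow> w \<in> S \<Longrightarrow> (\<lambda>t. c * v t + d * w t) \<in> S"
begin

lemma approximable_base: "w \<in> S \<Longrightarrow> uniformly_approximable T S w"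
  unfolding uniformly_approximable_def by (intro allI impI bexI[of _ w]) auto

lemma approximable_limit:
  assumes "\<And>\<epsilon>. \<epsilon> > 0 \<Longrightarrow> \<exists>v. uniformly_approximable T S v \<and> (\<forall>t\<in>{0..T}. \<bar>w t - v t\<bar> \<le> \<epsilon>)"
  shows "uniformly_approximable T S w"
  unfolding uniformly_approximable_def
proof (intro allI impI)
  fix \<epsilon> :: real assume "\<epsilon> > 0"
  then have "\<epsilon> / 2 > 0" by simp
  from assms[OF this] obtain v where "uniformly_approximable T S v"
    and v: "\<And>t. t \<in> {0..T} \<Longrightarrow> \<bar>w t - v t\<bar> \<le> \<epsilon> / 2"
    by blast
  with \<open>\<epsilon> / 2 > 0\<close> obtain u where "u \<in> S" and u: "\<And>t. t \<in> {0..T} \<Longrightarrow> \<bar>v t - u t\<bar> \<le> \<epsilon> / 2"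
    unfolding uniformly_approximable_def by blast
  have "\<bar>w t - u t\<bar> \<le> \<epsilon>" if "t \<in> {0..T}" for t
    using u[OF that] v[OF that] by linarith
  with \<open>u \<in> S\<close> show "\<exists>u\<in>S. \<forall>t\<in>{0..T}. \<bar>w t - u t\<bar> \<le> \<epsilon>" by blast
qed

lemma approximable_lincomb:
  assumes v: "uniformly_approximable T S v" and w: "uniformly_approximable T S w"
  shows "uniformly_approximable T S (\<lambda>t. c * v t + d * w t)"
  unfolding uniformly_approximable_def
proof (intro allI impI)
  fix \<epsilon> :: real assume "\<epsilon> > 0"
  define \<delta> where "\<delta> = \<epsilon> / (\<bar>c\<bar> + \<bar>d\<bar> + 1)"
  have "\<bar>c\<bar> + \<bar>d\<bar> + 1 > 0" by linarith
  then have "\<delta> > 0" and \<delta>: "(\<bar>c\<bar> + \<bar>d\<bar> + 1) * \<delta> = \<epsilon>"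
    using \<open>\<epsilon> > 0\<close> by (simp_all add: \<delta>_def)
  obtain v' w' where "v' \<in> S" "w' \<in> S"
    and v': "\<And>t. t \<in> {0..T} \<Longrightarrow> \<bar>v t - v' t\<bar> \<le> \<delta>" and w': "\<And>t. t \<in> {0..T} \<Longrightarrow> \<bar>w t - w' t\<bar> \<le> \<delta>"
    using v w \<open>\<delta> > 0\<close> unfolding uniformly_approximable_def by blast
  show "\<exists>u\<in>S. \<forall>t\<in>{0..T}. \<bar>c * v t + d * w t - u t\<bar> \<le> \<epsilon>"
  proof (intro bexI ballI)
    show "(\<lambda>t. c * v' t + d * w' t) \<in> S"
      by (rule lincomb) fact+
    fix t assume t: "t \<in> {0..T}"
    have "c * v t + d * w t - (c * v' t + d * w' t) = c * (v t - v' t) + d * (w t - w' t)"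
      by (simp add: algebra_simps)
    also have "\<bar>\<dots>\<bar> \<le> \<bar>c\<bar> * \<bar>v t - v' t\<bar> + \<bar>d\<bar> * \<bar>w t - w' t\<bar>"
      using abs_triangle_ineq[of "c * (v t - v' t)" "d * (w t - w' t)"] by (simp only: abs_mult)
    also have "\<dots> \<le> \<bar>c\<bar> * \<delta> + \<bar>d\<bar> * \<delta>"
      using v'[OF t] w'[OF t] by (intro add_mono mult_left_mono) auto
    also have "\<dots> \<le> \<epsilon>"
      using \<delta> \<open>\<delta> > 0\<close> by (simp add: algebra_simps)
    finally show "\<bar>c * v t + d * w t - (c * v' t + d * w' t)\<bar> \<le> \<epsilon>" .
  qed
qed

lemma approximable_sum:
  assumes "finite I" "S \<noteq> {}" "\<And>i. i \<in> I \<Longrightarrow> uniformly_approximable T S (w i)"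
  shows "uniformly_approximable T S (\<lambda>t. \<Sum>i\<in>I. c i * w i t)"
  using assms(1,3)
proof (induction I rule: finite_induct)
  case empty
  from \<open>S \<noteq> {}\<close> obtain v where "v \<in> S" by blast
  with lincomb[of v v 0 0] show ?case by (intro approximable_base) simp
next
  case (insert i I)
  then show ?case
    using approximable_lincomb[of "w i" "\<lambda>t. \<Sum>i\<in>I. c i * w i t" "c i" 1] by simp
qed

text \<open>Inverts \<open>x \<mapsto> x n - \<sigma> x (n + 1)\<close>, a discrete version of dividing by \<open>1 \<mp> exp (- d * sqrt s)\<close>;
partial sums suffice because the terms tend to zero.\<close>

lemma approximable_telescope:
  assumes steps: "\<And>n. uniformly_approximable T S (\<lambda>t. x n t - \<sigma> * x (Suc n) t)"
    and \<sigma>: "\<bar>\<sigma>\<bar> = 1"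
    and small: "\<And>\<epsilon>. \<epsilon> > 0 \<Longrightarrow> \<exists>n. \<forall>t\<in>{0..T}. \<bar>x n t\<bar> \<le> \<epsilon>"
  shows "uniformly_approximable T S (x 0)"
proof (rule approximable_limit)
  have sums: "uniformly_approximable T S (\<lambda>t. x 0 t - \<sigma> ^ n * x n t)" for n
  proof (induction n)
    case 0
    show ?case using approximable_lincomb[OF steps[of 0] steps[of 0], of 0 0] by simp
  next
    case (Suc n)
    have "x 0 t - \<sigma> ^ Suc n * x (Suc n) t
        = 1 * (x 0 t - \<sigma> ^ n * x n t) + \<sigma> ^ n * (x n t - \<sigma> * x (Suc n) t)" for t
      by (simp add: algebra_simps)
    then show ?case using approximable_lincomb[OF Suc steps[of n], of 1 "\<sigma> ^ n"] by (simp only:)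
  qed
  fix \<epsilon> :: real assume "\<epsilon> > 0"
  from small[OF this] obtain n where n: "\<forall>t\<in>{0..T}. \<bar>x n t\<bar> \<le> \<epsilon>" ..
  have "\<bar>x 0 t - (x 0 t - \<sigma> ^ n * x n t)\<bar> \<le> \<epsilon>" if "t \<in> {0..T}" for t
    using n that \<sigma> by (simp add: abs_mult power_abs)
  with sums[of n] show "\<exists>v. uniformly_approximable T S v \<and> (\<forall>t\<in>{0..T}. \<bar>x 0 t - v t\<bar> \<le> \<epsilon>)"
    by blast
qed

end

lemma source_kernel_uniform_decay:
  assumes "\<epsilon> > 0"
  shows "\<exists>R. \<forall>c\<ge>R. \<forall>t\<in>{0..T}. \<bar>source_kernel c (T - t)\<bar> \<le> \<epsilon>"
proof -
  have "continuous_on {0..T} (gauss_kernel 1 1)"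
    by (intro continuous_on_gauss_kernel continuous_intros) simp
  then have "bounded (gauss_kernel 1 1 ` {0..T})"
    by (intro compact_imp_bounded compact_continuous_image) auto
  then obtain B where "B > 0" and B: "\<And>t. t \<in> {0..T} \<Longrightarrow> \<bar>gauss_kernel 1 1 t\<bar> \<le> B"
    unfolding bounded_pos by auto
  define R where "R = max 1 (B / \<epsilon>)"
  have "\<bar>source_kernel c (T - t)\<bar> \<le> \<epsilon>" if c: "c \<ge> R" and t: "t \<in> {0..T}" for c t
  proof -
    have "c \<ge> 1" using c by (simp add: R_def)
    then have "1 \<le> c\<^sup>2" "c \<le> c\<^sup>2" by (simp_all add: one_le_power self_le_power)
    have "(T - t) / c\<^sup>2 \<le> T - t"
      using \<open>1 \<le> c\<^sup>2\<close> t by (simp add: divide_le_eq mult_le_cancel_left1)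
    then have u: "(T - t) / c\<^sup>2 \<in> {0..T}"
      using t by auto
    have "source_kernel c (T - t) = gauss_kernel 1 1 ((T - t) / c\<^sup>2) / c\<^sup>2"
      using \<open>c \<ge> 1\<close> gauss_kernel_scaling[of c 1 "T - t"]
      by (simp add: source_kernel_def power3_eq_cube power2_eq_square numeral_3_eq_3)
    then have "\<bar>source_kernel c (T - t)\<bar> \<le> B / c\<^sup>2"
      using B[OF u] by (simp add: abs_divide divide_right_mono)
    also have "\<dots> \<le> B / c"
      using \<open>B > 0\<close> \<open>c \<ge> 1\<close> \<open>c \<le> c\<^sup>2\<close> by (intro divide_left_mono) auto
    also have "\<dots> \<le> \<epsilon>"
    proof -
      have "B / \<epsilon> \<le> c" using c by (simp add: R_def)
      then show ?thesis using \<open>c \<ge> 1\<close> assms by (simp add: field_simps)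
    qed
    finally show ?thesis .
  qed
  then show ?thesis by blast
qed

text \<open>With \<open>P\<^sub>x = p\<close>, this is the outward normal derivative, in rescaled length, that the test function
on the second subdomain has at the interface; up to sign, its Laplace symbol relative to \<open>p\<close> is
\<open>4 sinh (A * sqrt s) * cosh (B * sqrt s)\<close>.\<close>

definition neumann_trace :: "real \<Rightarrow> real \<Rightarrow> (real \<times> real \<Rightarrow> real) \<Rightarrow> real \<Rightarrow> real" where
  "neumann_trace A B p t = p (A + B, t) + p (A - B, t) - p (B - A, t) - p (- A - B, t)"

definition neumann_traces :: "real \<Rightarrow> real \<Rightarrow> real \<Rightarrow> (real \<Rightarrow> real) set" where
  "neumann_traces A B T = neumann_trace A B ` {p. heat_profile (A + B) T p}"

lemma function_subspace_neumann_traces: "function_subspace (neumann_traces A B T)"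
proof
  fix v w c d assume "v \<in> neumann_traces A B T" "w \<in> neumann_traces A B T"
  then obtain p q where "heat_profile (A + B) T p" "heat_profile (A + B) T q"
    and vw: "v = neumann_trace A B p" "w = neumann_trace A B q"
    by (auto simp: neumann_traces_def)
  then have "heat_profile (A + B) T (\<lambda>z. c * p z + d * q z)"
    by (intro heat_profile_lincomb)
  moreover have "(\<lambda>t. c * v t + d * w t) = neumann_trace A B (\<lambda>z. c * p z + d * q z)"
    by (simp add: vw neumann_trace_def fun_eq_iff algebra_simps)
  ultimately show "(\<lambda>t. c * v t + d * w t) \<in> neumann_traces A B T"
    by (auto simp: neumann_traces_def)
qed

text \<open>The trace of a translated source kernel is the kernel hit by \<open>1 - exp (- 2 A * sqrt s)\<close> and
\<open>1 + exp (- 2 B * sqrt s)\<close>.  Each factor is a difference or sum of two translates and is undone by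
telescoping along translates that move off to infinity.\<close>

lemma source_kernel_approximable:
  assumes "A > 0" "B > 0" "z > 0"
  shows "uniformly_approximable T (neumann_traces A B T) (\<lambda>t. source_kernel z (T - t))"
proof -
  interpret function_subspace T "neumann_traces A B T"
    by (rule function_subspace_neumann_traces)
  let ?K = "\<lambda>c t. source_kernel c (T - t)"
  have far: "\<exists>n. z + 2 * real n * C \<ge> R" if "C > 0" for C R z :: real
  proof -
    obtain n where "R - z < real n * (2 * C)"
      using reals_Archimedean3[of "2 * C"] \<open>C > 0\<close> by auto
    then show ?thesis by (intro exI[of _ n]) (simp add: algebra_simps)
  qed
  have sum: "uniformly_approximable T (neumann_traces A B T) (\<lambda>t. ?K z t + ?K (z + 2 * B) t)" if "z > 0" for z
  proof -
    define x where "x n t = ?K (z + 2 * real n * A) t + ?K (z + 2 * real n * A + 2 * B) t" for n t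
    have "uniformly_approximable T (neumann_traces A B T) (x 0)"
    proof (rule approximable_telescope[where \<sigma> = 1])
      fix n
      let ?y = "z + 2 * real n * A + A + B"
      have "heat_profile (A + B) T (\<lambda>(x, t). source_kernel (?y + x) (T - t))"
        using assms \<open>z > 0\<close> by (intro heat_profile_source_kernel) (simp add: add_pos_nonneg)
      then have *: "neumann_trace A B (\<lambda>(x, t). source_kernel (?y + x) (T - t)) \<in> neumann_traces A B T"
        by (auto simp: neumann_traces_def)
      have "(\<lambda>t. x n t - 1 * x (Suc n) t)
          = (\<lambda>t. - 1 * neumann_trace A B (\<lambda>(x, t). source_kernel (?y + x) (T - t)) t
             + 0 * neumann_trace A B (\<lambda>(x, t). source_kernel (?y + x) (T - t)) t)"
        by (simp add: x_def neumann_trace_def fun_eq_iff algebra_simps)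
      then show "uniformly_approximable T (neumann_traces A B T) (\<lambda>t. x n t - 1 * x (Suc n) t)"
        using approximable_lincomb[OF approximable_base[OF *] approximable_base[OF *], of "- 1" 0] by simp
    next
      fix \<epsilon> :: real assume "\<epsilon> > 0"
      then obtain R where R: "\<forall>c\<ge>R. \<forall>t\<in>{0..T}. \<bar>?K c t\<bar> \<le> \<epsilon> / 2"
        using source_kernel_uniform_decay[of "\<epsilon> / 2" T] by auto
      obtain n where n: "z + 2 * real n * A \<ge> R" using far[OF \<open>A > 0\<close>] by blast
      have "\<bar>x n t\<bar> \<le> \<epsilon>" if "t \<in> {0..T}" for t
      proof -
        have "\<bar>?K (z + 2 * real n * A) t\<bar> \<le> \<epsilon> / 2" "\<bar>?K (z + 2 * real n * A + 2 * B) t\<bar> \<le> \<epsilon> / 2"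
          using R n that \<open>B > 0\<close> by auto
        then show ?thesis unfolding x_def by linarith
      qed
      then show "\<exists>n. \<forall>t\<in>{0..T}. \<bar>x n t\<bar> \<le> \<epsilon>" by blast
    qed simp
    then show ?thesis by (simp add: x_def[abs_def])
  qed
  define x where "x n t = ?K (z + 2 * real n * B) t" for n t
  have "uniformly_approximable T (neumann_traces A B T) (x 0)"
  proof (rule approximable_telescope[where \<sigma> = "- 1"])
    show "uniformly_approximable T (neumann_traces A B T) (\<lambda>t. x n t - - 1 * x (Suc n) t)" for n
      using sum[of "z + 2 * real n * B"] \<open>z > 0\<close> \<open>B > 0\<close>
      by (simp add: x_def algebra_simps add_pos_nonneg)
  next
    fix \<epsilon> :: real assume "\<epsilon> > 0"
    then obtain R where R: "\<forall>c\<ge>R. \<forall>t\<in>{0..T}. \<bar>?K c t\<bar> \<le> \<epsilon>"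
      using source_kernel_uniform_decay[of "\<epsilon>" T] by auto
    obtain n where "z + 2 * real n * B \<ge> R" using far[OF \<open>B > 0\<close>] by blast
    with R show "\<exists>n. \<forall>t\<in>{0..T}. \<bar>x n t\<bar> \<le> \<epsilon>" unfolding x_def by blast
  qed simp
  then show ?thesis by (simp add: x_def[abs_def])
qed

lemma gauss_kernel_2:
  "gauss_kernel j 2 t = (if t \<le> 0 then 0 else t powr (- (real j + 1 / 2)) * exp (- (1 / t)))"
  by (simp add: gauss_kernel_def)

text \<open>For \<open>c\<^sup>2 = 4 (i + 1)\<close> the source kernels are, up to constants, the products of one fixed kernel
\<open>\<omega>\<close> with the powers \<open>Z ^ i\<close>, \<open>Z = exp (- 1 / (T - t))\<close>.  As \<open>Z\<close> is strictly monotone on the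
time interval, polynomials in \<open>Z\<close> are uniformly dense in the continuous functions by the
Stone--Weierstrass theorem.\<close>

lemma gauss_kernel_times_continuous_approximable:
  assumes "A > 0" "B > 0" and k: "continuous_on {0..T} k"
  shows "uniformly_approximable T (neumann_traces A B T) (\<lambda>t. gauss_kernel 1 2 (T - t) * k t)"
proof -
  interpret function_subspace T "neumann_traces A B T"
    by (rule function_subspace_neumann_traces)
  \<comment> \<open>Equal to \<open>exp (- 1 / (T - t))\<close> for \<open>t < T\<close>; in this form continuity at \<open>T\<close> is immediate.\<close>
  define Z where "Z t = sqrt (T - t) * gauss_kernel 0 2 (T - t)" for t
  have Z_cont: "continuous_on {0..T} Z"
    unfolding Z_def[abs_def] by (intro continuous_intros continuous_on_gauss_kernel) simp
  have Z_eq: "Z t = (if t \<ge> T then 0 else exp (- (1 / (T - t))))" for t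
    by (simp add: Z_def gauss_kernel_2 powr_minus powr_half_sqrt)
  have Z_inj: "Z s \<noteq> Z t" if "s < t" "t \<le> T" for s t
    using that by (auto simp: Z_eq field_simps)
  let ?\<omega> = "\<lambda>t. gauss_kernel 1 2 (T - t)"
  have monomial: "?\<omega> t * Z t ^ i = source_kernel (2 * sqrt (real (Suc i))) (T - t) / (2 * sqrt (real (Suc i)))" for i t
  proof (cases "t \<ge> T")
    case False
    define u where "u = T - t"
    have "u > 0" using False by (simp add: u_def)
    have "exp (- (1 / u)) * exp (- (1 / u)) ^ i = exp (real (Suc i) * - (1 / u))"
      unfolding exp_of_nat_mult by simp
    also have "real (Suc i) * - (1 / u) = - ((2 * sqrt (real (Suc i)))\<^sup>2 / (4 * u))"
      using \<open>u > 0\<close> by (simp add: power_mult_distrib field_simps)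
    finally have "exp (- (1 / u)) * exp (- (1 / u)) ^ i = exp (- ((2 * sqrt (real (Suc i)))\<^sup>2 / (4 * u)))" .
    with \<open>u > 0\<close> False show ?thesis
      unfolding Z_eq gauss_kernel_2 source_kernel_def u_def[symmetric]
      by (simp add: gauss_kernel_def mult.assoc del: of_nat_Suc)
  qed (auto simp: gauss_kernel_def source_kernel_def)
  have poly: "uniformly_approximable T (neumann_traces A B T) (\<lambda>t. ?\<omega> t * poly q (Z t))" for q
  proof -
    have "uniformly_approximable T (neumann_traces A B T)
      (\<lambda>t. \<Sum>i\<le>degree q. coeff q i / (2 * sqrt (real (Suc i))) * source_kernel (2 * sqrt (real (Suc i))) (T - t))"
    proof (rule approximable_sum)
      show "neumann_traces A B T \<noteq> {}"
        using heat_profile_source_kernel[of "A + B" "A + B + 1" T] by (auto simp: neumann_traces_def)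
    qed (use assms in \<open>auto intro!: source_kernel_approximable\<close>)
    moreover have "?\<omega> t * poly q (Z t) = (\<Sum>i\<le>degree q. coeff q i / (2 * sqrt (real (Suc i))) * source_kernel (2 * sqrt (real (Suc i))) (T - t))" for t
    proof -
      have "?\<omega> t * poly q (Z t) = (\<Sum>i\<le>degree q. coeff q i * (?\<omega> t * Z t ^ i))"
        by (simp add: poly_altdef sum_distrib_left ac_simps)
      then show ?thesis by (simp only: monomial times_divide_eq_left times_divide_eq_right)
    qed
    ultimately show ?thesis by simp
  qed
  interpret SW: function_ring_on "{\<lambda>t. poly q (Z t) |q. True}" "{0..T}"
  proof
    fix f g assume "f \<in> {\<lambda>t. poly q (Z t) |q. True}" "g \<in> {\<lambda>t. poly q (Z t) |q. True}"
    then obtain p q where fg: "f = (\<lambda>t. poly p (Z t))" "g = (\<lambda>t. poly q (Z t))" by blast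
    show "(\<lambda>t. f t + g t) \<in> {\<lambda>t. poly q (Z t) |q. True}"
      unfolding fg by (auto intro!: exI[of _ "p + q"])
    show "(\<lambda>t. f t * g t) \<in> {\<lambda>t. poly q (Z t) |q. True}"
      unfolding fg by (auto intro!: exI[of _ "p * q"])
  next
    fix f assume "f \<in> {\<lambda>t. poly q (Z t) |q. True}"
    then show "continuous_on {0..T} f"
      by (auto intro!: continuous_intros Z_cont)
  next
    fix c show "(\<lambda>_. c) \<in> {\<lambda>t. poly q (Z t) |q. True}"
      by (auto intro!: exI[of _ "[:c:]"])
  next
    fix s t assume "s \<in> {0..T}" "t \<in> {0..T}" "s \<noteq> t"
    then have "Z s \<noteq> Z t"
      using Z_inj[of s t] Z_inj[of t s] by fastforce
    then show "\<exists>f\<in>{\<lambda>t. poly q (Z t) |q. True}. f s \<noteq> f t"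
      by (intro bexI[of _ "\<lambda>t. poly [:0, 1:] (Z t)"] CollectI exI[of _ "[:0, 1:]"]) simp_all
  qed auto
  have "continuous_on {0..T} ?\<omega>"
    by (intro continuous_intros continuous_on_gauss_kernel) simp
  then have "bounded (?\<omega> ` {0..T})"
    by (intro compact_imp_bounded compact_continuous_image) auto
  then obtain C where "C > 0" and C: "\<And>t. t \<in> {0..T} \<Longrightarrow> \<bar>?\<omega> t\<bar> \<le> C"
    unfolding bounded_pos by auto
  show ?thesis
  proof (rule approximable_limit)
    fix \<epsilon> :: real assume "\<epsilon> > 0"
    then have "\<epsilon> / C > 0" using \<open>C > 0\<close> by simp
    from SW.Stone_Weierstrass_basic[OF k this]
    obtain q where q: "\<And>t. t \<in> {0..T} \<Longrightarrow> \<bar>k t - poly q (Z t)\<bar> < \<epsilon> / C"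
      by blast
    have "\<bar>?\<omega> t * k t - ?\<omega> t * poly q (Z t)\<bar> \<le> \<epsilon>" if "t \<in> {0..T}" for t
    proof -
      have "\<bar>?\<omega> t * k t - ?\<omega> t * poly q (Z t)\<bar> = \<bar>?\<omega> t\<bar> * \<bar>k t - poly q (Z t)\<bar>"
        by (simp only: right_diff_distrib flip: abs_mult)
      also have "\<dots> \<le> C * (\<epsilon> / C)"
        using C[OF that] q[OF that] \<open>C > 0\<close> by (intro mult_mono) auto
      finally show ?thesis using \<open>C > 0\<close> by simp
    qed
    with poly[of q] show "\<exists>v. uniformly_approximable T (neumann_traces A B T) v \<and> (\<forall>t\<in>{0..T}. \<bar>?\<omega> t * k t - v t\<bar> \<le> \<epsilon>)"
      by (intro exI[of _ "\<lambda>t. ?\<omega> t * poly q (Z t)"]) auto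
  qed
qed

section \<open>One step of the iteration\<close>

abbreviation time_measure :: "real \<Rightarrow> real measure" where
  "time_measure T \<equiv> restrict_space lborel {0<..<T}"

lemma L2_on_iff_time_measure:
  "L2_on {0<..<T} f \<longleftrightarrow> f \<in> borel_measurable (time_measure T) \<and> integrable (time_measure T) (\<lambda>t. (f t)\<^sup>2)"
  unfolding L2_on_def set_borel_measurable_def set_integrable_def
  by (simp add: borel_measurable_restrict_space_iff integrable_restrict_space)

lemma set_integral_eq_time_measure:
  "(LINT t:{0<..<T}|lborel. f t) = (\<integral>t. f t \<partial>time_measure T)" for f :: "real \<Rightarrow> real"
  unfolding set_lebesgue_integral_def by (simp add: integral_restrict_space)

lemma integrable_product_of_squares:
  fixes f g :: "'a \<Rightarrow> real"
  assumes [measurable]: "f \<in> borel_measurable M" "g \<in> borel_measurable M"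
    and "integrable M (\<lambda>x. (f x)\<^sup>2)" "integrable M (\<lambda>x. (g x)\<^sup>2)"
  shows "integrable M (\<lambda>x. f x * g x)"
proof (rule Bochner_Integration.integrable_bound)
  show "integrable M (\<lambda>x. (f x)\<^sup>2 + (g x)\<^sup>2)"
    using assms by simp
  have "\<bar>u * v\<bar> \<le> u\<^sup>2 + v\<^sup>2" for u v :: real
    using sum_squares_bound[of "\<bar>u\<bar>" "\<bar>v\<bar>"] mult_nonneg_nonneg[of "\<bar>u\<bar>" "\<bar>v\<bar>"]
    unfolding abs_mult power2_abs by linarith
  then show "AE x in M. norm (f x * g x) \<le> norm ((f x)\<^sup>2 + (g x)\<^sup>2)"
    by (auto intro: order_trans)
qed measurable

lemma continuous_on_time_measure:
  fixes f :: "real \<Rightarrow> real"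
  assumes f: "continuous_on {0..T} f"
  shows "f \<in> borel_measurable (time_measure T)" "integrable (time_measure T) f"
    "integrable (time_measure T) (\<lambda>t. (f t)\<^sup>2)" "(\<integral>t. f t \<partial>time_measure T) = integral {0..T} f"
proof -
  have integrable: "integrable (time_measure T) g" if "continuous_on {0..T} g" for g :: "real \<Rightarrow> real"
  proof -
    have "set_integrable lborel {0..T} g"
      using that by (rule borel_integrable_atLeastAtMost')
    then have "set_integrable lborel {0<..<T} g"
      by (rule set_integrable_subset) auto
    then show ?thesis by (simp add: set_integrable_def integrable_restrict_space)
  qed
  show int: "integrable (time_measure T) f" "integrable (time_measure T) (\<lambda>t. (f t)\<^sup>2)"
    by (intro integrable continuous_intros f)+
  then show "f \<in> borel_measurable (time_measure T)" by auto
  have "(\<integral>t. f t \<partial>time_measure T) = integral {0<..<T} f"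
    using int(1) unfolding set_integral_eq_time_measure[symmetric]
    by (intro set_borel_integral_eq_integral) (simp add: set_integrable_def integrable_restrict_space)
  then show "(\<integral>t. f t \<partial>time_measure T) = integral {0..T} f"
    by (simp add: integral_open_interval_real)
qed

lemma heat_profile_continuous:
  assumes "heat_profile L T p" "x \<in> {- L..L}"
  shows "continuous_on {0..T} (\<lambda>t. p (x, t))"
proof -
  have "continuous_on ({- L..L} \<times> {0..T}) p"
    using assms by (auto simp: heat_profile_def C21_on_def)
  then show ?thesis
    by (rule continuous_on_compose2) (use assms(2) in \<open>auto intro!: continuous_intros\<close>)
qed

text \<open>The combination against which the old error is tested; up to sign, its Laplace symbol
relative to \<open>p\<close> is \<open>4 sinh ((A - B) * sqrt s)\<close>, so that its quotient with the one of \<open>neumann_trace\<close> is the symbol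
of one iteration step up to the factor \<open>1 - \<theta>\<close>.\<close>

definition updated_trace :: "real \<Rightarrow> real \<Rightarrow> (real \<times> real \<Rightarrow> real) \<Rightarrow> real \<Rightarrow> real" where
  "updated_trace A B p t = 2 * (p (A - B, t) - p (B - A, t))"

lemma continuous_on_traces:
  assumes "heat_profile (A + B) T p" "A > 0" "B > 0"
  shows "continuous_on {0..T} (neumann_trace A B p)" "continuous_on {0..T} (updated_trace A B p)"
  unfolding neumann_trace_def[abs_def] updated_trace_def[abs_def]
  by (intro continuous_intros heat_profile_continuous[OF assms(1)]; use assms(2,3) in force)+

lemma generalized_heat_solutionD:
  assumes "generalized_heat_solution \<alpha> \<kappa> T p q u g\<^sub>p F\<^sub>p g\<^sub>q F\<^sub>q"
    and "C21_on p q T \<phi> \<phi>\<^sub>t \<phi>\<^sub>x \<phi>\<^sub>x\<^sub>x" "\<And>x. x \<in> {p..q} \<Longrightarrow> \<phi> (x, T) = 0"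
    and "\<And>z. - \<alpha> * \<phi>\<^sub>t z - \<kappa> * \<phi>\<^sub>x\<^sub>x z = 0"
  shows "F\<^sub>p (\<lambda>t. \<phi> (p, t)) + \<kappa> * (\<integral>t. g\<^sub>p t * \<phi>\<^sub>x (p, t) \<partial>time_measure T)
    = F\<^sub>q (\<lambda>t. \<phi> (q, t)) + \<kappa> * (\<integral>t. g\<^sub>q t * \<phi>\<^sub>x (q, t) \<partial>time_measure T)"
proof -
  have "(LINT z:{p<..<q} \<times> {0<..<T}|lborel. u z * (- \<alpha> * \<phi>\<^sub>t z - \<kappa> * \<phi>\<^sub>x\<^sub>x z)) =
          (F\<^sub>p (\<lambda>t. \<phi> (p, t)) + \<kappa> * (LINT t:{0<..<T}|lborel. g\<^sub>p t * \<phi>\<^sub>x (p, t))) -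
          (F\<^sub>q (\<lambda>t. \<phi> (q, t)) + \<kappa> * (LINT t:{0<..<T}|lborel. g\<^sub>q t * \<phi>\<^sub>x (q, t)))"
    using assms(1-3) unfolding generalized_heat_solution_def by blast
  then show ?thesis
    by (simp only: assms(4) set_integral_eq_time_measure mult_zero_right) simp
qed

text \<open>Green's formula is tested on both subdomains with backward heat solutions that vanish at the outer
boundaries and coincide at the interface, namely \<open>4 sinh X * sinh B\<close> and \<open>4 sinh A * sinh Y\<close>
applied to \<open>P\<close>, where \<open>X\<close> and \<open>Y\<close> are the distances to the outer boundaries in units in which
both diffusivities are one.  The interface flux \<open>F\<close> is then evaluated at the same function in both
formulas and cancels, which leaves \<open>\<kappa>\<^sub>1 \<integral> h \<phi>\<^sub>1\<^sub>x = \<kappa>\<^sub>2 \<integral> g \<phi>\<^sub>2\<^sub>x\<close>.  With the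
given \<open>\<theta>\<close> the update combines the two traces through
\<open>sinh A cosh B - cosh A sinh B = sinh (A - B)\<close>.\<close>

lemma dnwr_step_duality:
  fixes a b T \<alpha>\<^sub>1 \<alpha>\<^sub>2 \<kappa>\<^sub>1 \<kappa>\<^sub>2 :: real
  defines "A \<equiv> sqrt (\<alpha>\<^sub>1 / \<kappa>\<^sub>1) * a" and "B \<equiv> sqrt (\<alpha>\<^sub>2 / \<kappa>\<^sub>2) * b"
    and "s\<^sub>1 \<equiv> sqrt (\<alpha>\<^sub>1 * \<kappa>\<^sub>1)" and "s\<^sub>2 \<equiv> sqrt (\<alpha>\<^sub>2 * \<kappa>\<^sub>2)"
  assumes pos: "a > 0" "b > 0" "\<alpha>\<^sub>1 > 0" "\<alpha>\<^sub>2 > 0" "\<kappa>\<^sub>1 > 0" "\<kappa>\<^sub>2 > 0"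
    and step: "dnwr_step a b T \<alpha>\<^sub>1 \<kappa>\<^sub>1 \<alpha>\<^sub>2 \<kappa>\<^sub>2 (s\<^sub>2 / (s\<^sub>1 + s\<^sub>2)) h h'"
    and h': "L2_on {0<..<T} h'"
    and p: "heat_profile (A + B) T p"
  shows "(\<integral>t. h' t * neumann_trace A B p t \<partial>time_measure T)
    = s\<^sub>1 / (s\<^sub>1 + s\<^sub>2) * (\<integral>t. h t * updated_trace A B p t \<partial>time_measure T)"
proof -
  define \<mu>\<^sub>1 \<mu>\<^sub>2 where "\<mu>\<^sub>1 = sqrt (\<alpha>\<^sub>1 / \<kappa>\<^sub>1)" and "\<mu>\<^sub>2 = sqrt (\<alpha>\<^sub>2 / \<kappa>\<^sub>2)"
  have \<mu>_pos: "\<mu>\<^sub>1 > 0" "\<mu>\<^sub>2 > 0" and s_pos: "s\<^sub>1 > 0" "s\<^sub>2 > 0"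
    using pos by (simp_all add: \<mu>\<^sub>1_def \<mu>\<^sub>2_def s\<^sub>1_def s\<^sub>2_def)
  have AB: "A = \<mu>\<^sub>1 * a" "B = \<mu>\<^sub>2 * b" by (simp_all add: A_def B_def \<mu>\<^sub>1_def \<mu>\<^sub>2_def)
  then have AB_pos: "A > 0" "B > 0" using pos \<mu>_pos by simp_all
  have \<mu>_sq: "\<kappa>\<^sub>1 * \<mu>\<^sub>1\<^sup>2 = \<alpha>\<^sub>1" "\<kappa>\<^sub>2 * \<mu>\<^sub>2\<^sup>2 = \<alpha>\<^sub>2"
    using pos by (simp_all add: \<mu>\<^sub>1_def \<mu>\<^sub>2_def)
  have flux: "\<kappa>\<^sub>1 * \<mu>\<^sub>1 = s\<^sub>1" "\<kappa>\<^sub>2 * \<mu>\<^sub>2 = s\<^sub>2"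
  proof -
    have "\<kappa> * sqrt (\<alpha> / \<kappa>) = sqrt (\<alpha> * \<kappa>)" if "\<kappa> > 0" for \<alpha> \<kappa> :: real
      using that by (simp add: real_sqrt_divide real_sqrt_mult field_simps)
    then show "\<kappa>\<^sub>1 * \<mu>\<^sub>1 = s\<^sub>1" "\<kappa>\<^sub>2 * \<mu>\<^sub>2 = s\<^sub>2"
      using pos by (simp_all add: \<mu>\<^sub>1_def \<mu>\<^sub>2_def s\<^sub>1_def s\<^sub>2_def)
  qed
  obtain u\<^sub>1 u\<^sub>2 F\<^sub>a F F\<^sub>b g where
    sol1: "generalized_heat_solution \<alpha>\<^sub>1 \<kappa>\<^sub>1 T (- a) 0 u\<^sub>1 (\<lambda>t. 0) F\<^sub>a h F" and
    sol2: "generalized_heat_solution \<alpha>\<^sub>2 \<kappa>\<^sub>2 T 0 b u\<^sub>2 g F (\<lambda>t. 0) F\<^sub>b" and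
    upd: "AE t in lborel. t \<in> {0<..<T} \<longrightarrow> h' t = (1 - s\<^sub>2 / (s\<^sub>1 + s\<^sub>2)) * h t + s\<^sub>2 / (s\<^sub>1 + s\<^sub>2) * g t"
    using step unfolding dnwr_step_def by blast
  obtain P p' p'' where P: "C21_on (- (A + B)) (A + B) T P (\<lambda>z. - p' z) p p'"
    and P_T: "\<And>x. x \<in> {- (A + B)..A + B} \<Longrightarrow> P (x, T) = 0"
    using p unfolding heat_profile_def by blast
  define \<phi>\<^sub>1 where "\<phi>\<^sub>1 z = images 1 (- 1) (- 1) 1 B P (\<mu>\<^sub>1 * fst z + A, snd z)" for z
  define \<phi>\<^sub>2 where "\<phi>\<^sub>2 z = images 1 (- 1) (- 1) 1 A P (- \<mu>\<^sub>2 * fst z + B, snd z)" for z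
  have range1: "\<mu>\<^sub>1 * x + A \<in> {0..A}" if "x \<in> {- a..0}" for x
    using that \<mu>_pos mult_left_mono[of "- a" x \<mu>\<^sub>1] by (simp add: AB mult_nonneg_nonpos)
  have range2: "- \<mu>\<^sub>2 * x + B \<in> {0..B}" if "x \<in> {0..b}" for x
    using that \<mu>_pos mult_left_mono[of x b \<mu>\<^sub>2] by (simp add: AB)
  have C1: "C21_on (- a) 0 T \<phi>\<^sub>1
      (\<lambda>z. images 1 (- 1) (- 1) 1 B (\<lambda>z. - p' z) (\<mu>\<^sub>1 * fst z + A, snd z))
      (\<lambda>z. \<mu>\<^sub>1 * images 1 (- 1) (- (- 1)) (- 1) B p (\<mu>\<^sub>1 * fst z + A, snd z))
      (\<lambda>z. \<mu>\<^sub>1\<^sup>2 * images 1 (- 1) (- 1) 1 B p' (\<mu>\<^sub>1 * fst z + A, snd z))"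
    unfolding \<phi>\<^sub>1_def[abs_def]
    by (rule C21_on_affine[OF C21_on_images[OF P, of 0 A B]]) (use AB_pos range1 in force)+
  have C2: "C21_on 0 b T \<phi>\<^sub>2
      (\<lambda>z. images 1 (- 1) (- 1) 1 A (\<lambda>z. - p' z) (- \<mu>\<^sub>2 * fst z + B, snd z))
      (\<lambda>z. - \<mu>\<^sub>2 * images 1 (- 1) (- (- 1)) (- 1) A p (- \<mu>\<^sub>2 * fst z + B, snd z))
      (\<lambda>z. (- \<mu>\<^sub>2)\<^sup>2 * images 1 (- 1) (- 1) 1 A p' (- \<mu>\<^sub>2 * fst z + B, snd z))"
    unfolding \<phi>\<^sub>2_def[abs_def]
    by (rule C21_on_affine[OF C21_on_images[OF P, of 0 B A]]) (use AB_pos range2 in force)+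
  note images_T = images_eq_0[where f = P and L = "A + B" and t = T, OF P_T]
  have T1: "\<phi>\<^sub>1 (x, T) = 0" if "x \<in> {- a..0}" for x
    unfolding \<phi>\<^sub>1_def fst_conv snd_conv using range1[OF that] AB_pos by (intro images_T) auto
  have T2: "\<phi>\<^sub>2 (x, T) = 0" if "x \<in> {0..b}" for x
    unfolding \<phi>\<^sub>2_def fst_conv snd_conv using range2[OF that] AB_pos by (intro images_T) auto
  have outer: "\<phi>\<^sub>1 (- a, t) = 0" "\<phi>\<^sub>2 (b, t) = 0" for t
    by (simp_all add: \<phi>\<^sub>1_def \<phi>\<^sub>2_def AB images_def)
  have swap: "- B - A = - A - B" "B + A = A + B" by simp_all
  have interface: "\<phi>\<^sub>1 (0, t) = \<phi>\<^sub>2 (0, t)" for t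
    by (simp add: \<phi>\<^sub>1_def \<phi>\<^sub>2_def images_def swap)
  define D where "D t = p (A + B, t) - p (A - B, t) + p (B - A, t) - p (- A - B, t)" for t
  have slope1: "images 1 (- 1) (- (- 1)) (- 1) B p (\<mu>\<^sub>1 * 0 + A, t) = D t" for t
    by (simp add: images_def D_def swap)
  have slope2: "images 1 (- 1) (- (- 1)) (- 1) A p (- \<mu>\<^sub>2 * 0 + B, t) = neumann_trace A B p t" for t
    by (simp add: images_def neumann_trace_def swap)
  have pde1: "- \<alpha>\<^sub>1 * images 1 (- 1) (- 1) 1 B (\<lambda>z. - p' z) (\<mu>\<^sub>1 * fst z + A, snd z)
      - \<kappa>\<^sub>1 * (\<mu>\<^sub>1\<^sup>2 * images 1 (- 1) (- 1) 1 B p' (\<mu>\<^sub>1 * fst z + A, snd z)) = 0" for z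
    unfolding images_minus mult.assoc[symmetric] \<mu>_sq by simp
  have pde2: "- \<alpha>\<^sub>2 * images 1 (- 1) (- 1) 1 A (\<lambda>z. - p' z) (- \<mu>\<^sub>2 * fst z + B, snd z)
      - \<kappa>\<^sub>2 * ((- \<mu>\<^sub>2)\<^sup>2 * images 1 (- 1) (- 1) 1 A p' (- \<mu>\<^sub>2 * fst z + B, snd z)) = 0" for z
    unfolding images_minus mult.assoc[symmetric] power2_minus \<mu>_sq by simp
  have "F\<^sub>a (\<lambda>t. 0) = F (\<lambda>t. \<phi>\<^sub>1 (0, t)) + \<kappa>\<^sub>1 * (\<integral>t. h t * (\<mu>\<^sub>1 * D t) \<partial>time_measure T)"
    using generalized_heat_solutionD[OF sol1 C1 T1 pde1] unfolding fst_conv snd_conv slope1 outer by simp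
  moreover have "F (\<lambda>t. \<phi>\<^sub>1 (0, t)) + \<kappa>\<^sub>2 * (\<integral>t. g t * (- \<mu>\<^sub>2 * neumann_trace A B p t) \<partial>time_measure T)
      = F\<^sub>b (\<lambda>t. 0)"
    using generalized_heat_solutionD[OF sol2 C2 T2 pde2] unfolding fst_conv snd_conv slope2 outer interface by simp
  moreover have "C21_on p q T (\<lambda>z. 0) (\<lambda>z. 0) (\<lambda>z. 0) (\<lambda>z. 0)" for p q
    by (simp add: C21_on_def)
  \<comment> \<open>\<open>F\<close> is an arbitrary functional, so its value at zero has to be read off from Green's formula.\<close>
  then have "F\<^sub>a (\<lambda>t. 0) = F (\<lambda>t. 0)" "F (\<lambda>t. 0) = F\<^sub>b (\<lambda>t. 0)"
    using generalized_heat_solutionD[OF sol1, of "\<lambda>_. 0" "\<lambda>_. 0" "\<lambda>_. 0" "\<lambda>_. 0"]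
      generalized_heat_solutionD[OF sol2, of "\<lambda>_. 0" "\<lambda>_. 0" "\<lambda>_. 0" "\<lambda>_. 0"] by simp_all
  moreover have "(\<integral>t. f t * (c * w t) \<partial>M) = c * (\<integral>t. f t * w t \<partial>M)" for f w :: "real \<Rightarrow> real" and c M
    by (subst integral_mult_right_zero[symmetric]) (simp add: ac_simps)
  ultimately have "\<kappa>\<^sub>1 * (\<mu>\<^sub>1 * (\<integral>t. h t * D t \<partial>time_measure T))
      = - (\<kappa>\<^sub>2 * (\<mu>\<^sub>2 * (\<integral>t. g t * neumann_trace A B p t \<partial>time_measure T)))"
    by simp
  then have gW: "s\<^sub>2 * (\<integral>t. g t * neumann_trace A B p t \<partial>time_measure T) = - (s\<^sub>1 * (\<integral>t. h t * D t \<partial>time_measure T))"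
    by (simp flip: flux mult.assoc)
  have h: "h \<in> borel_measurable (time_measure T)" "integrable (time_measure T) (\<lambda>t. (h t)\<^sup>2)"
    using sol1 by (auto simp: generalized_heat_solution_def L2_on_iff_time_measure)
  have g: "g \<in> borel_measurable (time_measure T)" "integrable (time_measure T) (\<lambda>t. (g t)\<^sup>2)"
    using sol2 by (auto simp: generalized_heat_solution_def L2_on_iff_time_measure)
  have W: "continuous_on {0..T} (neumann_trace A B p)" and V: "continuous_on {0..T} (updated_trace A B p)"
    using continuous_on_traces[OF p AB_pos] by blast+
  have int: "integrable (time_measure T) (\<lambda>t. h t * neumann_trace A B p t)"
     "integrable (time_measure T) (\<lambda>t. g t * neumann_trace A B p t)"
     "integrable (time_measure T) (\<lambda>t. h t * updated_trace A B p t)"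
    by (intro integrable_product_of_squares h g continuous_on_time_measure W V)+
  have D: "h t * D t = h t * neumann_trace A B p t - h t * updated_trace A B p t" for t
    by (simp add: D_def neumann_trace_def updated_trace_def algebra_simps)
  have "(\<integral>t. h' t * neumann_trace A B p t \<partial>time_measure T) = (\<integral>t. s\<^sub>1 / (s\<^sub>1 + s\<^sub>2) * (h t * neumann_trace A B p t)
      + s\<^sub>2 / (s\<^sub>1 + s\<^sub>2) * (g t * neumann_trace A B p t) \<partial>time_measure T)"
  proof -
    have upd': "AE t in time_measure T. h' t = s\<^sub>1 / (s\<^sub>1 + s\<^sub>2) * h t + s\<^sub>2 / (s\<^sub>1 + s\<^sub>2) * g t"
    proof -
      have "1 - s\<^sub>2 / (s\<^sub>1 + s\<^sub>2) = s\<^sub>1 / (s\<^sub>1 + s\<^sub>2)"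
        using s_pos by (simp add: field_simps)
      with upd show ?thesis by (simp add: AE_restrict_space_iff)
    qed
    have "AE t in time_measure T. h' t * neumann_trace A B p t = s\<^sub>1 / (s\<^sub>1 + s\<^sub>2) * (h t * neumann_trace A B p t)
      + s\<^sub>2 / (s\<^sub>1 + s\<^sub>2) * (g t * neumann_trace A B p t)"
      using upd' by eventually_elim (simp add: distrib_right)
    moreover have "h' \<in> borel_measurable (time_measure T)"
      using h' by (simp add: L2_on_iff_time_measure)
    ultimately show ?thesis
      using h(1) g(1) continuous_on_time_measure(1)[OF W]
      by (intro integral_cong_AE borel_measurable_add borel_measurable_times borel_measurable_const)
  qed
  also have "\<dots> = s\<^sub>1 / (s\<^sub>1 + s\<^sub>2) * (\<integral>t. h t * neumann_trace A B p t \<partial>time_measure T)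
      + (s\<^sub>2 * (\<integral>t. g t * neumann_trace A B p t \<partial>time_measure T)) / (s\<^sub>1 + s\<^sub>2)"
    using int by simp
  also have "\<dots> = s\<^sub>1 / (s\<^sub>1 + s\<^sub>2) * (\<integral>t. h t * updated_trace A B p t \<partial>time_measure T)"
    unfolding gW D using int by (simp add: right_diff_distrib diff_divide_distrib)
  finally show ?thesis .
qed

text \<open>Two backward heat solutions connect the traces, mirroring the factorisation
\<open>sinh (A - B) / (sinh A * cosh B)\<close>.  The first, \<open>v\<^sub>1\<close> with the symbol \<open>sinh x * cosh B\<close>, vanishes
at \<open>x = 0\<close> and equals the Neumann trace at \<open>x = A\<close>; from there to \<open>x = A - B\<close> its norm drops by
the factor \<open>(A - B) / A\<close>.  The second, \<open>v\<^sub>2\<close> with the symbol \<open>sinh (A - B) * cosh x\<close>, is even in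
\<open>x\<close>.  Its value at \<open>x = B\<close> is that of \<open>v\<^sub>1\<close> at \<open>A - B\<close>, its value at \<open>x = 0\<close> is the updated trace,
and between the two its norm drops by the factor \<open>1 / cosh (\<sigma> * B)\<close>.\<close>

lemma trace_energy:
  fixes A B \<sigma> T :: real
  assumes "0 < B" "B < A" "T > 0" and p: "heat_profile (A + B) T p"
  shows "(\<integral>t. exp (2 * \<sigma>\<^sup>2 * t) * (updated_trace A B p t)\<^sup>2 \<partial>time_measure T)
    \<le> ((A - B) / A / cosh (\<sigma> * B))\<^sup>2 * (\<integral>t. exp (2 * \<sigma>\<^sup>2 * t) * (neumann_trace A B p t)\<^sup>2 \<partial>time_measure T)"
proof -
  obtain p' p'' where C: "C21_on (- (A + B)) (A + B) T p (\<lambda>z. - p'' z) p' p''"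
    and p_T: "\<And>x. x \<in> {- (A + B)..A + B} \<Longrightarrow> p (x, T) = 0"
    using p unfolding heat_profile_def by blast
  note images_T = images_eq_0[where f = p and L = "A + B" and t = T, OF p_T]
  define v\<^sub>1 where "v\<^sub>1 = images 1 1 (- 1) (- 1) B p"
  define v\<^sub>2 where "v\<^sub>2 = images 1 (- 1) 1 (- 1) (A - B) p"
  define N\<^sub>1 where "N\<^sub>1 x = integral {0..T} (\<lambda>t. exp (2 * \<sigma>\<^sup>2 * t) * (v\<^sub>1 (x, t))\<^sup>2)" for x
  define N\<^sub>2 where "N\<^sub>2 x = integral {0..T} (\<lambda>t. exp (2 * \<sigma>\<^sup>2 * t) * (v\<^sub>2 (x, t))\<^sup>2)" for x
  \<comment> \<open>The comparison function would be \<open>x\<close>; the shift keeps it positive at \<open>x = 0\<close>.\<close>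
  have "N\<^sub>1 (A - B) / (A - B + \<epsilon>)\<^sup>2 \<le> N\<^sub>1 A / (A + \<epsilon>)\<^sup>2" if "\<epsilon> > 0" for \<epsilon>
    unfolding N\<^sub>1_def
  proof (rule backward_heat_energy[where S = "\<lambda>x. x + \<epsilon>" and S' = "\<lambda>_. 1" and S'' = "\<lambda>_. 0"
        and x = "A - B" and y = A and p = 0 and q = A])
    show "C21_on 0 A T v\<^sub>1 (images 1 1 (- 1) (- 1) B (\<lambda>z. - p'' z))
        (images 1 1 (- (- 1)) (- (- 1)) B p') (images 1 1 (- 1) (- 1) B p'')"
      unfolding v\<^sub>1_def by (rule C21_on_images[OF C]) (use assms in auto)
    show "v\<^sub>1 (x, T) = 0" if "x \<in> {0..A}" for x
      unfolding v\<^sub>1_def using that assms by (intro images_T) auto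
    show "((\<lambda>x. x + \<epsilon>) has_real_derivative 1) (at x within {0..A})" for x
      by (auto intro!: derivative_eq_intros)
    show "((\<lambda>x. 1) has_real_derivative 0) (at x within {0..A})" for x
      by simp
  qed (use assms \<open>\<epsilon> > 0\<close> in \<open>auto simp: images_minus v\<^sub>1_def images_def\<close>)
  then have "\<forall>\<^sub>F \<epsilon> in at_right 0. N\<^sub>1 (A - B) / (A - B + \<epsilon>)\<^sup>2 \<le> N\<^sub>1 A / (A + \<epsilon>)\<^sup>2"
    by (simp add: eventually_at_filter)
  moreover have lim: "((\<lambda>\<epsilon>. N\<^sub>1 (A - B) / (A - B + \<epsilon>)\<^sup>2) \<longlongrightarrow> N\<^sub>1 (A - B) / (A - B + 0)\<^sup>2) (at_right 0)"
    "((\<lambda>\<epsilon>. N\<^sub>1 A / (A + \<epsilon>)\<^sup>2) \<longlongrightarrow> N\<^sub>1 A / (A + 0)\<^sup>2) (at_right 0)"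
    using assms by (intro tendsto_intros; simp)+
  ultimately have "N\<^sub>1 (A - B) / (A - B + 0)\<^sup>2 \<le> N\<^sub>1 A / (A + 0)\<^sup>2"
    by (intro tendsto_le[OF _ lim(2) lim(1)]) simp_all
  then have N1: "(A - B)\<^sup>2 * (N\<^sub>1 (A - B) / (A - B)\<^sup>2) \<le> (A - B)\<^sup>2 * (N\<^sub>1 A / A\<^sup>2)"
    by (intro mult_left_mono) simp_all
  have N2: "N\<^sub>2 0 / (cosh (\<sigma> * 0))\<^sup>2 \<le> N\<^sub>2 B / (cosh (\<sigma> * B))\<^sup>2"
    unfolding N\<^sub>2_def
  proof (rule backward_heat_energy[where S = "\<lambda>x. cosh (\<sigma> * x)" and S' = "\<lambda>x. \<sigma> * sinh (\<sigma> * x)"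
        and S'' = "\<lambda>x. \<sigma>\<^sup>2 * cosh (\<sigma> * x)" and x = 0 and y = B and p = 0 and q = B])
    show "C21_on 0 B T v\<^sub>2 (images 1 (- 1) 1 (- 1) (A - B) (\<lambda>z. - p'' z))
        (images 1 (- 1) (- 1) (- (- 1)) (A - B) p') (images 1 (- 1) 1 (- 1) (A - B) p'')"
      unfolding v\<^sub>2_def by (rule C21_on_images[OF C]) (use assms in auto)
    show "v\<^sub>2 (x, T) = 0" if "x \<in> {0..B}" for x
      unfolding v\<^sub>2_def using that assms by (intro images_T) auto
    show "((\<lambda>x. cosh (\<sigma> * x)) has_real_derivative \<sigma> * sinh (\<sigma> * x)) (at x within {0..B})" for x
      by (auto intro!: derivative_eq_intros)
    show "((\<lambda>x. \<sigma> * sinh (\<sigma> * x)) has_real_derivative \<sigma>\<^sup>2 * cosh (\<sigma> * x)) (at x within {0..B})" for x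
      by (auto intro!: derivative_eq_intros simp: power2_eq_square)
  qed (use assms in \<open>auto simp: images_minus images_def\<close>)
  have match: "v\<^sub>2 (B, t) = v\<^sub>1 (A - B, t)" "v\<^sub>1 (A, t) = neumann_trace A B p t" "v\<^sub>2 (0, t) = updated_trace A B p t" for t
  proof -
    have eqs: "- B - A = - A - B" "B - (A - B) = 2 * B - A" "- (A - B) - B = - A" "B + (A - B) = A" "A - B - B = A - 2 * B"
      "- B - (A - B) = - A" "A - B + B = A" "B - (A - B) = 2 * B - A" "- (A - B) = B - A"
      by simp_all
    show "v\<^sub>2 (B, t) = v\<^sub>1 (A - B, t)" "v\<^sub>1 (A, t) = neumann_trace A B p t" "v\<^sub>2 (0, t) = updated_trace A B p t"
      unfolding v\<^sub>1_def v\<^sub>2_def images_def neumann_trace_def updated_trace_def prod.case by (simp_all add: eqs)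
  qed
  have "N\<^sub>2 0 \<le> N\<^sub>2 B / (cosh (\<sigma> * B))\<^sup>2" using N2 by simp
  also have "N\<^sub>2 B = N\<^sub>1 (A - B)" by (simp add: N\<^sub>1_def N\<^sub>2_def match)
  also have "N\<^sub>1 (A - B) \<le> ((A - B) / A)\<^sup>2 * N\<^sub>1 A"
    using N1 assms by (simp add: power_divide)
  finally have "N\<^sub>2 0 \<le> ((A - B) / A / cosh (\<sigma> * B))\<^sup>2 * N\<^sub>1 A"
    by (simp add: divide_right_mono power_divide power_mult_distrib)
  moreover have "continuous_on {0..T} (\<lambda>t. exp (2 * \<sigma>\<^sup>2 * t) * (updated_trace A B p t)\<^sup>2)"
    "continuous_on {0..T} (\<lambda>t. exp (2 * \<sigma>\<^sup>2 * t) * (neumann_trace A B p t)\<^sup>2)"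
    using assms by (intro continuous_intros continuous_on_traces[OF p]; simp)+
  note this[THEN continuous_on_time_measure(4)]
  ultimately show ?thesis
    by (simp add: N\<^sub>1_def N\<^sub>2_def match)
qed

text \<open>Duality between the weights \<open>exp (- \<sigma>\<^sup>2 t)\<close> for the errors and \<open>exp (\<sigma>\<^sup>2 t)\<close> for the traces:
the step is contracting in the first because the map from Neumann to updated traces is in the second.
Density of the Neumann traces turns the estimate on test functions into one for the norm.\<close>

lemma dnwr_step_contraction:
  fixes a b T \<alpha>\<^sub>1 \<alpha>\<^sub>2 \<kappa>\<^sub>1 \<kappa>\<^sub>2 \<sigma> :: real
  defines "A \<equiv> sqrt (\<alpha>\<^sub>1 / \<kappa>\<^sub>1) * a" and "B \<equiv> sqrt (\<alpha>\<^sub>2 / \<kappa>\<^sub>2) * b"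
    and "s\<^sub>1 \<equiv> sqrt (\<alpha>\<^sub>1 * \<kappa>\<^sub>1)" and "s\<^sub>2 \<equiv> sqrt (\<alpha>\<^sub>2 * \<kappa>\<^sub>2)"
  assumes pos: "a > 0" "b > 0" "\<alpha>\<^sub>1 > 0" "\<alpha>\<^sub>2 > 0" "\<kappa>\<^sub>1 > 0" "\<kappa>\<^sub>2 > 0" and "T > 0" and "B < A"
    and step: "dnwr_step a b T \<alpha>\<^sub>1 \<kappa>\<^sub>1 \<alpha>\<^sub>2 \<kappa>\<^sub>2 (s\<^sub>2 / (s\<^sub>1 + s\<^sub>2)) h h'"
    and h: "L2_on {0<..<T} h" and h': "L2_on {0<..<T} h'"
  shows "(\<integral>t. (exp (- \<sigma>\<^sup>2 * t) * h' t)\<^sup>2 \<partial>time_measure T)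
    \<le> (s\<^sub>1 / (s\<^sub>1 + s\<^sub>2) * ((A - B) / A / cosh (\<sigma> * B)))\<^sup>2 * (\<integral>t. (exp (- \<sigma>\<^sup>2 * t) * h t)\<^sup>2 \<partial>time_measure T)"
proof -
  let ?M = "time_measure T"
  define \<rho> where "\<rho> = s\<^sub>1 / (s\<^sub>1 + s\<^sub>2)"
  define m where "m = (A - B) / A / cosh (\<sigma> * B)"
  define f where "f t = exp (- \<sigma>\<^sup>2 * t) * h t" for t
  define f' where "f' t = exp (- \<sigma>\<^sup>2 * t) * h' t" for t
  define X where "X = (\<rho> * m)\<^sup>2 * (\<integral>t. (f t)\<^sup>2 \<partial>?M)"
  have AB: "A > 0" "B > 0" using pos by (simp_all add: A_def B_def)
  have "m > 0" using AB \<open>B < A\<close> by (simp add: m_def cosh_real_pos)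
  have weighted: "(\<lambda>t. exp (- \<sigma>\<^sup>2 * t) * g t) \<in> borel_measurable ?M \<and> integrable ?M (\<lambda>t. (exp (- \<sigma>\<^sup>2 * t) * g t)\<^sup>2)"
    if "L2_on {0<..<T} g" for g
  proof
    have g: "g \<in> borel_measurable ?M" "integrable ?M (\<lambda>t. (g t)\<^sup>2)"
      using that by (auto simp: L2_on_iff_time_measure)
    have "continuous_on {0..T} (\<lambda>t. exp (- \<sigma>\<^sup>2 * t))" by (intro continuous_intros)
    from continuous_on_time_measure(1)[OF this] g(1)
    show meas: "(\<lambda>t. exp (- \<sigma>\<^sup>2 * t) * g t) \<in> borel_measurable ?M" by (rule borel_measurable_times)
    show "integrable ?M (\<lambda>t. (exp (- \<sigma>\<^sup>2 * t) * g t)\<^sup>2)"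
    proof (rule Bochner_Integration.integrable_bound[OF g(2)])
      show "(\<lambda>t. (exp (- \<sigma>\<^sup>2 * t) * g t)\<^sup>2) \<in> borel_measurable ?M"
        using meas by (rule borel_measurable_power)
      show "AE t in ?M. norm ((exp (- \<sigma>\<^sup>2 * t) * g t)\<^sup>2) \<le> norm ((g t)\<^sup>2)"
      proof (rule AE_I2)
        fix t assume "t \<in> space ?M"
        then have "(exp (- \<sigma>\<^sup>2 * t))\<^sup>2 \<le> 1"
          by (intro power_le_one) (auto simp: space_restrict_space)
        then show "norm ((exp (- \<sigma>\<^sup>2 * t) * g t)\<^sup>2) \<le> norm ((g t)\<^sup>2)"
          by (simp add: power_mult_distrib mult_left_le_one_le)
      qed
    qed
  qed
  have f: "f \<in> borel_measurable ?M" "integrable ?M (\<lambda>t. (f t)\<^sup>2)"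
    and f': "f' \<in> borel_measurable ?M" "integrable ?M (\<lambda>t. (f' t)\<^sup>2)"
    using weighted[OF h] weighted[OF h'] by (simp_all add: f_def[abs_def] f'_def[abs_def])
  have exp_cancel: "exp (- \<sigma>\<^sup>2 * t) * x * (exp (\<sigma>\<^sup>2 * t) * y) = x * y" for x y t :: real
    by (simp add: exp_minus)
  have exp_sq: "(exp (\<sigma>\<^sup>2 * t) * x)\<^sup>2 = exp (2 * \<sigma>\<^sup>2 * t) * x\<^sup>2" for x t :: real
    by (simp add: power_mult_distrib mult.assoc flip: exp_double)
  \<comment> \<open>Young's inequality with weight \<open>m\<close>, followed by the energy bound for the traces.\<close>
  have base: "(\<integral>t. 2 * f' t * (exp (\<sigma>\<^sup>2 * t) * v t) - (exp (\<sigma>\<^sup>2 * t) * v t)\<^sup>2 \<partial>?M) \<le> X"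
    if v: "v \<in> neumann_traces A B T" for v
  proof -
    obtain p where p: "heat_profile (A + B) T p" and v: "v = neumann_trace A B p"
      using v by (auto simp: neumann_traces_def)
    define w where "w t = exp (\<sigma>\<^sup>2 * t) * v t" for t
    define w' where "w' t = exp (\<sigma>\<^sup>2 * t) * updated_trace A B p t" for t
    have cont: "continuous_on {0..T} w" "continuous_on {0..T} w'"
      unfolding w_def[abs_def] w'_def[abs_def] v
      by (intro continuous_intros continuous_on_traces[OF p AB])+
    note w = continuous_on_time_measure[OF cont(1)] and w' = continuous_on_time_measure[OF cont(2)]
    have int: "integrable ?M (\<lambda>t. f' t * w t)" "integrable ?M (\<lambda>t. f t * w' t)"
      by (intro integrable_product_of_squares f f' w w')+
    have dual: "(\<integral>t. f' t * w t \<partial>?M) = \<rho> * (\<integral>t. f t * w' t \<partial>?M)"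
      using dnwr_step_duality[OF pos step[unfolded s\<^sub>1_def s\<^sub>2_def] h' p[unfolded A_def B_def]]
      unfolding f'_def w_def f_def w'_def exp_cancel v by (simp add: \<rho>_def A_def B_def s\<^sub>1_def s\<^sub>2_def)
    have energy: "(\<integral>t. (w' t)\<^sup>2 \<partial>?M) \<le> m\<^sup>2 * (\<integral>t. (w t)\<^sup>2 \<partial>?M)"
      using trace_energy[OF AB(2) \<open>B < A\<close> \<open>T > 0\<close> p, of \<sigma>] by (simp add: w_def w'_def v exp_sq m_def)
    have "(\<integral>t. 2 * f' t * w t - (w t)\<^sup>2 \<partial>?M) = 2 * (\<integral>t. f' t * w t \<partial>?M) - (\<integral>t. (w t)\<^sup>2 \<partial>?M)"
      using int(1) w(3) by (simp add: mult.assoc)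
    also have "2 * (\<integral>t. f' t * w t \<partial>?M) = (\<integral>t. 2 * (\<rho> * (f t * w' t)) \<partial>?M)"
      using int(2) by (simp add: dual)
    also have "\<dots> \<le> (\<integral>t. (\<rho> * m)\<^sup>2 * (f t)\<^sup>2 + (w' t)\<^sup>2 / m\<^sup>2 \<partial>?M)"
    proof (rule integral_mono)
      show "2 * (\<rho> * (f t * w' t)) \<le> (\<rho> * m)\<^sup>2 * (f t)\<^sup>2 + (w' t)\<^sup>2 / m\<^sup>2" for t
        using sum_squares_bound[of "\<rho> * m * f t" "w' t / m"] \<open>m > 0\<close>
        by (simp add: power_mult_distrib power_divide mult.assoc)
    qed (use int f w' in auto)
    also have "\<dots> = X + (\<integral>t. (w' t)\<^sup>2 \<partial>?M) / m\<^sup>2"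
      using f w' by (simp add: X_def)
    also have "(\<integral>t. (w' t)\<^sup>2 \<partial>?M) / m\<^sup>2 \<le> (\<integral>t. (w t)\<^sup>2 \<partial>?M)"
      using energy \<open>m > 0\<close> by (simp add: divide_le_eq mult.commute)
    finally show ?thesis by (simp add: w_def)
  qed
  have closed: "(\<integral>t. 2 * f' t * (exp (\<sigma>\<^sup>2 * t) * v t) - (exp (\<sigma>\<^sup>2 * t) * v t)\<^sup>2 \<partial>?M) \<le> X"
    if v: "uniformly_approximable T (neumann_traces A B T) v" and v_cont: "continuous_on {0..T} v" for v
  proof -
    have "\<exists>u. u \<in> neumann_traces A B T \<and> (\<forall>t\<in>{0..T}. \<bar>v t - u t\<bar> \<le> 1 / real (Suc n))" for n
      using v unfolding uniformly_approximable_def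
      by (metis of_nat_0_less_iff zero_less_Suc zero_less_divide_1_iff)
    then obtain u where u: "\<And>n. u n \<in> neumann_traces A B T"
      and close: "\<And>n t. t \<in> {0..T} \<Longrightarrow> \<bar>v t - u n t\<bar> \<le> 1 / real (Suc n)"
      by metis
    have u_cont: "continuous_on {0..T} (u n)" for n
      using u[of n] continuous_on_traces(1)[OF _ AB] by (auto simp: neumann_traces_def)
    have space: "t \<in> {0..T}" if "t \<in> space ?M" for t
      using that by (auto simp: space_restrict_space)
    show ?thesis
    proof (rule integral_quadratic_limit[where w\<^sub>n = "\<lambda>n t. exp (\<sigma>\<^sup>2 * t) * u n t"
          and g = "\<lambda>t. exp (\<sigma>\<^sup>2 * t) * (\<bar>v t\<bar> + 1)"])
      show "AE t in ?M. (\<lambda>n. exp (\<sigma>\<^sup>2 * t) * u n t) \<longlonglongrightarrow> exp (\<sigma>\<^sup>2 * t) * v t"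
      proof (rule AE_I2)
        fix t assume t: "t \<in> space ?M"
        have "(\<lambda>n. u n t - v t) \<longlonglongrightarrow> 0"
        proof (rule Lim_null_comparison)
          show "\<forall>\<^sub>F n in sequentially. norm (u n t - v t) \<le> 1 / real (Suc n)"
            using close[OF space[OF t]] by (simp add: abs_minus_commute)
          show "(\<lambda>n. 1 / real (Suc n)) \<longlonglongrightarrow> 0"
            using LIMSEQ_inverse_real_of_nat by (simp add: inverse_eq_divide)
        qed
        then have "(\<lambda>n. u n t) \<longlonglongrightarrow> v t" by (simp add: LIM_zero_cancel)
        then show "(\<lambda>n. exp (\<sigma>\<^sup>2 * t) * u n t) \<longlonglongrightarrow> exp (\<sigma>\<^sup>2 * t) * v t"
          by (intro tendsto_intros)
      qed
      show "\<bar>exp (\<sigma>\<^sup>2 * t) * u n t\<bar> \<le> exp (\<sigma>\<^sup>2 * t) * (\<bar>v t\<bar> + 1)" if "t \<in> space ?M" for n t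
      proof -
        have "1 / real (Suc n) \<le> 1" by simp
        then have "\<bar>u n t\<bar> \<le> \<bar>v t\<bar> + 1"
          using close[OF space[OF that], of n] by linarith
        then show ?thesis by (simp add: abs_mult)
      qed
      show "integrable ?M (\<lambda>t. (exp (\<sigma>\<^sup>2 * t) * (\<bar>v t\<bar> + 1))\<^sup>2)"
        by (intro continuous_on_time_measure(3) continuous_intros v_cont)
      show "(\<lambda>t. exp (\<sigma>\<^sup>2 * t) * v t) \<in> borel_measurable ?M"
        by (intro continuous_on_time_measure(1) continuous_intros v_cont)
      show "(\<lambda>t. exp (\<sigma>\<^sup>2 * t) * u n t) \<in> borel_measurable ?M" for n
        by (intro continuous_on_time_measure(1) continuous_intros u_cont)
    qed (use f' base[OF u] in auto)
  qed
  define \<omega> where "\<omega> t = exp (\<sigma>\<^sup>2 * t) * gauss_kernel 1 2 (T - t)" for t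
  have kernel_cont: "continuous_on {0..T} (\<lambda>t. gauss_kernel 1 2 (T - t))"
    by (intro continuous_on_gauss_kernel continuous_intros) simp_all
  then have \<omega>_cont: "continuous_on {0..T} \<omega>"
    unfolding \<omega>_def[abs_def] by (intro continuous_on_mult continuous_on_exp continuous_intros) simp_all
  have "(\<integral>t. (f' t)\<^sup>2 \<partial>?M) \<le> X"
  proof (rule integral_square_le_by_duality[where \<omega> = \<omega>])
    show "\<omega> t > 0" if "t \<in> {0<..<T}" for t
      using that by (simp add: \<omega>_def gauss_kernel_def)
    show "(\<integral>t. 2 * f' t * (\<omega> t * k t) - (\<omega> t * k t)\<^sup>2 \<partial>?M) \<le> X" if "continuous_on UNIV k" for k
    proof -
      have k: "continuous_on {0..T} k" using that by (rule continuous_on_subset) simp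
      show ?thesis
        using closed[OF gauss_kernel_times_continuous_approximable[OF AB k]]
          continuous_on_mult[OF kernel_cont k] by (simp add: \<omega>_def mult.assoc)
    qed
  qed (use f' continuous_on_time_measure[OF \<omega>_cont] in auto)
  then show ?thesis
    by (simp add: X_def f_def f'_def \<rho>_def m_def)
qed

section \<open>The superlinear estimate\<close>

theorem theorem2:
  fixes a b T \<alpha>\<^sub>1 \<alpha>\<^sub>2 \<kappa>\<^sub>1 \<kappa>\<^sub>2 \<theta> :: real and h :: "nat \<Rightarrow> real \<Rightarrow> real" and k :: nat
  assumes "a > 0" and "b > 0" and "T > 0"
    and "\<alpha>\<^sub>1 > 0" and "\<alpha>\<^sub>2 > 0" and "\<kappa>\<^sub>1 > 0" and "\<kappa>\<^sub>2 > 0"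
    and "\<theta> = sqrt (\<alpha>\<^sub>2 * \<kappa>\<^sub>2) / (sqrt (\<alpha>\<^sub>1 * \<kappa>\<^sub>1) + sqrt (\<alpha>\<^sub>2 * \<kappa>\<^sub>2))"
    and "sqrt (\<alpha>\<^sub>1 / \<kappa>\<^sub>1) * a > sqrt (\<alpha>\<^sub>2 / \<kappa>\<^sub>2) * b"
    and "L2_on {0<..<T} (h 0)"
    and "dnwr_errors a b T \<alpha>\<^sub>1 \<kappa>\<^sub>1 \<alpha>\<^sub>2 \<kappa>\<^sub>2 \<theta> h"
    and "k \<ge> 1"
  shows "L2_norm_on {0<..<T} (h k) \<le>
    (2 * ((1 - sqrt (\<alpha>\<^sub>2 * \<kappa>\<^sub>1 / (\<alpha>\<^sub>1 * \<kappa>\<^sub>2)) * (b / a)) /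
          (1 + sqrt (\<alpha>\<^sub>2 * \<kappa>\<^sub>2 / (\<alpha>\<^sub>1 * \<kappa>\<^sub>1))))) ^ k *
    exp (- (\<alpha>\<^sub>2 * (real k)\<^sup>2 * b\<^sup>2 / (4 * \<kappa>\<^sub>2 * T))) * L2_norm_on {0<..<T} (h 0)"
proof -
  note pos = assms(1,2,4-7)
  let ?M = "time_measure T"
  define A B where "A = sqrt (\<alpha>\<^sub>1 / \<kappa>\<^sub>1) * a" and "B = sqrt (\<alpha>\<^sub>2 / \<kappa>\<^sub>2) * b"
  define s\<^sub>1 s\<^sub>2 where "s\<^sub>1 = sqrt (\<alpha>\<^sub>1 * \<kappa>\<^sub>1)" and "s\<^sub>2 = sqrt (\<alpha>\<^sub>2 * \<kappa>\<^sub>2)"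
  have AB: "A > 0" "B > 0" "B < A" using assms by (simp_all add: A_def B_def)
  have s_pos: "s\<^sub>1 > 0" "s\<^sub>2 > 0" using pos by (simp_all add: s\<^sub>1_def s\<^sub>2_def)
  \<comment> \<open>The choice that minimises the exponent \<open>\<sigma>\<^sup>2 T - k \<sigma> B\<close>.\<close>
  define \<sigma> where "\<sigma> = real k * B / (2 * T)"
  define \<rho> where "\<rho> = s\<^sub>1 / (s\<^sub>1 + s\<^sub>2)"
  define m where "m = \<rho> * ((A - B) / A / cosh (\<sigma> * B))"
  define I where "I n = (\<integral>t. (exp (- \<sigma>\<^sup>2 * t) * h n t)\<^sup>2 \<partial>?M)" for n
  have step: "dnwr_step a b T \<alpha>\<^sub>1 \<kappa>\<^sub>1 \<alpha>\<^sub>2 \<kappa>\<^sub>2 (s\<^sub>2 / (s\<^sub>1 + s\<^sub>2)) (h n) (h (Suc n))" for n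
    using assms unfolding dnwr_errors_def s\<^sub>1_def s\<^sub>2_def by blast
  have L2: "L2_on {0<..<T} (h n)" for n
    using step[of n] unfolding dnwr_step_def generalized_heat_solution_def by blast
  have "\<rho> > 0" "m \<ge> 0"
    using s_pos AB by (simp_all add: \<rho>_def m_def less_imp_le[OF cosh_real_pos])
  have "I (Suc n) \<le> m\<^sup>2 * I n" for n
    unfolding I_def m_def \<rho>_def A_def B_def s\<^sub>1_def s\<^sub>2_def
    by (rule dnwr_step_contraction[OF pos \<open>T > 0\<close> _ step[of n, unfolded s\<^sub>1_def s\<^sub>2_def] L2 L2]) fact
  then have iterate: "I n \<le> (m\<^sup>2) ^ n * I 0" for n
  proof (induction n)
    case (Suc n)
    have "I (Suc n) \<le> m\<^sup>2 * I n" by fact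
    also have "\<dots> \<le> m\<^sup>2 * ((m\<^sup>2) ^ n * I 0)"
      using Suc by (intro mult_left_mono) auto
    finally show ?case by (simp add: mult.assoc)
  qed simp
  define J where "J n = (\<integral>t. (h n t)\<^sup>2 \<partial>?M)" for n
  have J: "integrable ?M (\<lambda>t. (h n t)\<^sup>2)" and [measurable]: "h n \<in> borel_measurable ?M" for n
    using L2[of n] by (auto simp: L2_on_iff_time_measure)
  have weight: "(exp (- \<sigma>\<^sup>2 * t) * x)\<^sup>2 \<le> x\<^sup>2" "exp (- 2 * \<sigma>\<^sup>2 * T) * x\<^sup>2 \<le> (exp (- \<sigma>\<^sup>2 * t) * x)\<^sup>2"
    if "t \<in> space ?M" for t x :: real
  proof -
    have t: "0 < t" "t < T" using that by (auto simp: space_restrict_space)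
    have eq: "(exp (- \<sigma>\<^sup>2 * t) * x)\<^sup>2 = exp (- 2 * \<sigma>\<^sup>2 * t) * x\<^sup>2"
      by (simp add: power_mult_distrib flip: exp_double)
    have "exp (- 2 * \<sigma>\<^sup>2 * t) \<le> 1" "exp (- 2 * \<sigma>\<^sup>2 * T) \<le> exp (- 2 * \<sigma>\<^sup>2 * t)"
      using t by (auto intro: mult_left_mono)
    from this[THEN mult_right_mono, of "x\<^sup>2"]
    show "(exp (- \<sigma>\<^sup>2 * t) * x)\<^sup>2 \<le> x\<^sup>2" "exp (- 2 * \<sigma>\<^sup>2 * T) * x\<^sup>2 \<le> (exp (- \<sigma>\<^sup>2 * t) * x)\<^sup>2"
      unfolding eq by simp_all
  qed
  have exp_meas: "(\<lambda>t. exp (- \<sigma>\<^sup>2 * t)) \<in> borel_measurable ?M"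
    by (intro continuous_on_time_measure(1) continuous_intros)
  have I_int: "integrable ?M (\<lambda>t. (exp (- \<sigma>\<^sup>2 * t) * h n t)\<^sup>2)" for n
  proof (rule Bochner_Integration.integrable_bound[OF J[of n]])
    show "AE t in ?M. norm ((exp (- \<sigma>\<^sup>2 * t) * h n t)\<^sup>2) \<le> norm ((h n t)\<^sup>2)"
      by (rule AE_I2) (use weight(1) in simp)
  qed (use exp_meas in measurable)
  have "exp (- 2 * \<sigma>\<^sup>2 * T) * J k = (\<integral>t. exp (- 2 * \<sigma>\<^sup>2 * T) * (h k t)\<^sup>2 \<partial>?M)"
    by (simp add: J_def)
  also have "\<dots> \<le> I k"
    unfolding I_def using weight(2) by (intro integral_mono I_int integrable_mult_right J) auto
  also have "\<dots> \<le> (m\<^sup>2) ^ k * I 0" by (rule iterate)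
  also have "\<dots> \<le> (m\<^sup>2) ^ k * J 0"
    unfolding I_def J_def using weight(1) by (intro mult_left_mono integral_mono I_int J) auto
  finally have "exp (- 2 * \<sigma>\<^sup>2 * T) * J k \<le> (m\<^sup>2) ^ k * J 0" .
  then have "exp (2 * \<sigma>\<^sup>2 * T) * (exp (- 2 * \<sigma>\<^sup>2 * T) * J k) \<le> exp (2 * \<sigma>\<^sup>2 * T) * ((m\<^sup>2) ^ k * J 0)"
    by (rule mult_left_mono) simp
  also have "exp (2 * \<sigma>\<^sup>2 * T) * (exp (- 2 * \<sigma>\<^sup>2 * T) * J k) = J k"
    by (simp add: exp_minus)
  also have "exp (2 * \<sigma>\<^sup>2 * T) = (exp (\<sigma>\<^sup>2 * T))\<^sup>2"
    by (simp add: mult.assoc flip: exp_double)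
  also have "(m\<^sup>2) ^ k = (m ^ k)\<^sup>2"
    by (simp add: mult.commute flip: power_mult)
  finally have "J k \<le> (exp (\<sigma>\<^sup>2 * T) * m ^ k)\<^sup>2 * J 0"
    by (simp only: power_mult_distrib mult.assoc)
  then have "sqrt (J k) \<le> sqrt ((exp (\<sigma>\<^sup>2 * T) * m ^ k)\<^sup>2 * J 0)"
    by (rule real_sqrt_le_mono)
  also have "\<dots> = exp (\<sigma>\<^sup>2 * T) * m ^ k * sqrt (J 0)"
    using \<open>m \<ge> 0\<close> by (simp add: real_sqrt_mult)
  also have "m ^ k \<le> (2 * (\<rho> * ((A - B) / A))) ^ k * exp (- (\<sigma> * B)) ^ k"
  proof -
    have "1 / cosh (\<sigma> * B) \<le> 2 * exp (- (\<sigma> * B))"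
      by (simp add: cosh_def exp_minus field_simps add_pos_pos)
    then have "\<rho> * ((A - B) / A) * (1 / cosh (\<sigma> * B)) \<le> \<rho> * ((A - B) / A) * (2 * exp (- (\<sigma> * B)))"
      using \<open>\<rho> > 0\<close> AB by (intro mult_left_mono) auto
    also have "\<rho> * ((A - B) / A) * (1 / cosh (\<sigma> * B)) = m"
      by (simp add: m_def)
    also have "\<rho> * ((A - B) / A) * (2 * exp (- (\<sigma> * B))) = 2 * (\<rho> * ((A - B) / A)) * exp (- (\<sigma> * B))"
      by (simp only: ac_simps)
    finally have "m \<le> 2 * (\<rho> * ((A - B) / A)) * exp (- (\<sigma> * B))" .
    from power_mono[OF this \<open>m \<ge> 0\<close>, of k] show ?thesis
      by (simp only: power_mult_distrib)
  qed
  finally have "sqrt (J k) \<le> exp (\<sigma>\<^sup>2 * T) * ((2 * (\<rho> * ((A - B) / A))) ^ k * exp (- (\<sigma> * B)) ^ k) * sqrt (J 0)"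
    by (simp add: mult_right_mono J_def)
  also have "exp (\<sigma>\<^sup>2 * T) * ((2 * (\<rho> * ((A - B) / A))) ^ k * exp (- (\<sigma> * B)) ^ k)
      = (2 * (\<rho> * ((A - B) / A))) ^ k * (exp (\<sigma>\<^sup>2 * T) * exp (- (\<sigma> * B)) ^ k)"
    by simp
  also have "exp (\<sigma>\<^sup>2 * T) * exp (- (\<sigma> * B)) ^ k = exp (- (\<alpha>\<^sub>2 * (real k)\<^sup>2 * b\<^sup>2 / (4 * \<kappa>\<^sub>2 * T)))"
  proof -
    have "\<sigma>\<^sup>2 * T + real k * - (\<sigma> * B) = - ((real k)\<^sup>2 * B\<^sup>2 / (4 * T))"
      using \<open>T > 0\<close> by (simp add: \<sigma>_def field_simps power2_eq_square)
    also have "B\<^sup>2 = \<alpha>\<^sub>2 / \<kappa>\<^sub>2 * b\<^sup>2"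
      using pos by (simp add: B_def power_mult_distrib)
    also have "- ((real k)\<^sup>2 * (\<alpha>\<^sub>2 / \<kappa>\<^sub>2 * b\<^sup>2) / (4 * T)) = - (\<alpha>\<^sub>2 * (real k)\<^sup>2 * b\<^sup>2 / (4 * \<kappa>\<^sub>2 * T))"
      by (simp add: ac_simps)
    finally show ?thesis
      by (simp only: exp_of_nat_mult[symmetric] exp_add[symmetric])
  qed
  also have "\<rho> * ((A - B) / A) = (1 - sqrt (\<alpha>\<^sub>2 * \<kappa>\<^sub>1 / (\<alpha>\<^sub>1 * \<kappa>\<^sub>2)) * (b / a)) /
          (1 + sqrt (\<alpha>\<^sub>2 * \<kappa>\<^sub>2 / (\<alpha>\<^sub>1 * \<kappa>\<^sub>1)))"
  proof -
    have ratio: "sqrt (\<alpha>\<^sub>2 * \<kappa>\<^sub>2 / (\<alpha>\<^sub>1 * \<kappa>\<^sub>1)) = s\<^sub>2 / s\<^sub>1"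
      by (simp add: s\<^sub>1_def s\<^sub>2_def real_sqrt_divide)
    have "\<rho> = 1 / (1 + sqrt (\<alpha>\<^sub>2 * \<kappa>\<^sub>2 / (\<alpha>\<^sub>1 * \<kappa>\<^sub>1)))"
      unfolding ratio using s_pos by (simp add: \<rho>_def field_simps)
    moreover have "sqrt (\<alpha>\<^sub>2 * \<kappa>\<^sub>1 / (\<alpha>\<^sub>1 * \<kappa>\<^sub>2)) * (b / a) = B / A"
      by (simp add: A_def B_def real_sqrt_divide real_sqrt_mult ac_simps)
    then have "(A - B) / A = 1 - sqrt (\<alpha>\<^sub>2 * \<kappa>\<^sub>1 / (\<alpha>\<^sub>1 * \<kappa>\<^sub>2)) * (b / a)"
      using AB by (simp add: diff_divide_distrib)
    ultimately show ?thesis by simp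
  qed
  finally show ?thesis
    by (simp add: J_def L2_norm_on_def set_integral_eq_time_measure)
qed

end
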